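(* In either case (a) or case (b) of the context, as $N\to\infty$ the random vector $X(N)$ converges in distribution to the constant $x^*$, and its moment generating function $M_{X(N)}(\xi)=\mathbb{E}\,e^{\xi^TX(N)}$ satisfies, for each fixed $\xi\in\mathbb{R}^m$ with $|\xi|<h$, $$M_{X(N)}(\xi)=e^{\xi^Tx^*}\bigg(1+\frac{O(1)}{\sqrt N}+O(1)\,\epsilon(N)\bigg),\qquad N\to\infty .$$
   Context: $\mathbb{Z}_+$ is the set of positive integers. $\Omega\subset\mathbb{R}^m$ is open and $\Omega'\subset\Omega$ is the closed ball centered at the origin with radius $\varepsilon>0$. $f:\Omega\times\mathbb{Z}_+\to\mathbb{R}$ is such that $f(\cdot,N)$ and its $x$-derivatives up to third order exist on $\Omega'$ and are bounded there uniformly in $x$ and $N$, and the Hessian $D^2f(x,N)$ is nonsingular there. Write $x=(x_1,y)$, $y=(x_2,\dots,x_m)$, and let $D_y$ be differentiation in $y$. Put $\Omega_+=\Omega$ in case (a) and $\Omega_+=\Omega\cap\{x:x_1\ge0\}$ in case (b). There is $N_0\in\mathbb{Z}_+$ such that for all $N\ge N_0$ the function $f(\cdot,N)$ has a unique maximum on $\Omega_+$, attained at $x^*(N)\in\Omega'$, with $$\Delta:=\inf_{N\ge N_0,\ x\in\Omega\setminus\Omega'}\{f(x^*(N),N)-f(x,N)\}>0 .$$ The origin of coordinates is $x^*=\lim_{N\to\infty}x^*(N)$. Case (a): $x^*(N)$ lies in the interior of $\Omega'$, and $\inf_{x\in\Omega',N\ge N_0}\|D^2f(x,N)^{-1/2}\|^{-2}>0$,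 $\inf_{x\in\Omega',N\ge N_0}\sqrt{|\det D^2f(x,N)|}>0$, $\sup_{x\in\Omega',N\ge N_0}\|D^2f(x,N)\|<\infty$, $\sup_{x\in\Omega',N\ge N_0}\|D^3f(x,N)\|<\infty$. Case (b): $x^*(N)\in\{x:x_1=0\}$, and $\inf_{x\in\Omega',N\ge N_0}|\partial f(x,N)/\partial x_1|>0$, $\inf_{x\in\Omega',N\ge N_0}\|D_y^2f(x,N)^{-1/2}\|^{-2}>0$, $\inf_{x\in\Omega',N\ge N_0}\sqrt{|\det D_y^2f(x,N)|}>0$, $\sup_{x\in\Omega',N\ge N_0}\|D^2f(x,N)\|<\infty$, $\sup_{x\in\Omega',N\ge N_0}\|D^3f(x,N)\|<\infty$; moreover for every $x_1\in(0,\varepsilon)$ the set $\arg\max_{y\in\Omega'(x_1)}f(x_1,y,N)$ is a single point, where $\Omega'(x_1)=\{y:(x_1,y)\in\Omega'\}$. (Here $\|A^{-1/2}\|^{-2}$ is the smallest absolute value of an eigenvalue of the symmetric matrix $A$.) In addition $f(x,N)=f(x)+\epsilon(N)\sigma(x)$, where $f,\sigma$ are functions of $x$ with derivatives up to second order at $x^*$, the Hessian $D^2f(x^* )$ is nonsingular, and $\epsilon(N)>0$, $\epsilon(N)\to0$ as $N\to\infty$. There is $h>0$ such that for every $|\xi|<h$ the function $g(x)=e^{\xi^Tx}$ (in particular $g\equiv1$) has $\int_{\Omega_+}g(x)e^{Nf(x,N)}dx$ existing and finite and admits a constant $C>0$ with $C\ge\int_\Omega g(x)e^{N_0f(x,N)}dx$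 for all $N\ge N_0$. For $N\ge N_0$, $X(N)$ is the random vector with values in $\Omega_+$ and distribution $$P_N(X(N)\in A)=\frac{\int_Ae^{Nf(x,N)}dx}{\int_{\Omega_+}e^{Nf(x,N)}dx},\qquad A\in\mathcal{B}(\Omega_+)\ \text{(Borel sets)}.$$ *)

theory Defs
  imports "HOL-Probability.Probability" "HOL-Library.Landau_Symbols"
begin

text \<open>
  Derivatives are taken within a set \<open>S\<close>. For \<open>S\<close> a closed ball of positive radius they are
  uniquely determined at every point, agree with the ordinary ones in the interior, and need no
  information on \<open>f\<close> outside \<open>S\<close>; \<open>S = UNIV\<close> gives the ordinary derivatives.
\<close>

definition grad :: "(real^'n \<Rightarrow> real) \<Rightarrow> (real^'n) set \<Rightarrow> real^'n \<Rightarrow> real^'n" where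
  "grad f S x = (\<chi> i. frechet_derivative f (at x within S) (axis i 1))"

definition hess :: "(real^'n \<Rightarrow> real) \<Rightarrow> (real^'n) set \<Rightarrow> real^'n \<Rightarrow> real^'n^'n" where
  "hess f S x = matrix (frechet_derivative (grad f S) (at x within S))"

text \<open>\<open>(third_deriv f S x u *v v) \<bullet> w\<close> is the trilinear form \<open>D\<^sup>3f(x)[u,v,w]\<close>.\<close>

definition third_deriv ::
  "(real^'n \<Rightarrow> real) \<Rightarrow> (real^'n) set \<Rightarrow> real^'n \<Rightarrow> real^'n \<Rightarrow> real^'n^'n" where
  "third_deriv f S x = frechet_derivative (hess f S) (at x within S)"

definition thrice_differentiable_on :: "(real^'n \<Rightarrow> real) \<Rightarrow> (real^'n) set \<Rightarrow> bool" where
  "thrice_differentiable_on f S \<longleftrightarrow>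
     f differentiable_on S \<and> grad f S differentiable_on S \<and> hess f S differentiable_on S"

definition twice_differentiable_at :: "(real^'n \<Rightarrow> real) \<Rightarrow> real^'n \<Rightarrow> bool" where
  "twice_differentiable_at f x \<longleftrightarrow>
     (\<forall>\<^sub>F z in nhds x. f differentiable (at z)) \<and> grad f UNIV differentiable (at x)"

text \<open>Operator norms; the library norm on \<open>real^'n^'n\<close> is the Frobenius norm.\<close>

definition mat_norm :: "real^'n^'n \<Rightarrow> real" where
  "mat_norm A = onorm ((*v) A)"

definition trilinear_norm :: "(real^'n \<Rightarrow> real^'n^'n) \<Rightarrow> real" where
  "trilinear_norm T = (SUP u\<in>cball 0 1. mat_norm (T u))"

text \<open>
  Determinant and eigenvalues of the principal submatrix of \<open>A\<close> with rows and columns in \<open>I\<close>;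
  \<open>I = UNIV\<close> is the whole matrix and \<open>I = - {k}\<close> deletes the \<open>k\<close>-th row and column. The empty
  submatrix has determinant 1 and no eigenvalue.
\<close>

definition sub_det :: "'n set \<Rightarrow> real^'n^'n \<Rightarrow> real" where
  "sub_det I A = (\<Sum>p | p permutes I. of_int (sign p) * (\<Prod>i\<in>I. A $ i $ p i))"

definition sub_eigenvalues :: "'n set \<Rightarrow> real^'n^'n \<Rightarrow> real set" where
  "sub_eigenvalues I A =
     {l. \<exists>v::real^'n. v \<noteq> 0 \<and> (\<forall>i. i \<notin> I \<longrightarrow> v $ i = 0) \<and>
        (\<forall>i\<in>I. (\<Sum>j\<in>I. A $ i $ j * v $ j) = l * v $ i)}"

lemma sub_det_UNIV: "sub_det UNIV A = det A"
  by (simp add: sub_det_def det_def)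

lemma sub_eigenvalues_UNIV: "sub_eigenvalues UNIV A = {l. \<exists>v. v \<noteq> 0 \<and> A *v v = l *\<^sub>R v}"
  by (simp add: sub_eigenvalues_def matrix_vector_mult_def vec_eq_iff)

text \<open>
  \<open>\<parallel>A\<^sup>-\<^sup>1\<^sup>/\<^sup>2\<parallel>\<^sup>-\<^sup>2\<close>, the smallest absolute value of an eigenvalue; it is \<open>\<infinity>\<close> for the empty
  submatrix.
\<close>

definition min_abs_eigenvalue :: "'n set \<Rightarrow> real^'n^'n \<Rightarrow> ereal" where
  "min_abs_eigenvalue I A = (INF l\<in>sub_eigenvalues I A. ereal \<bar>l\<bar>)"

text \<open>\<open>B\<close> is the closed ball \<open>\<Omega>'\<close>, and \<open>xs N\<close> is the maximiser of \<open>f(\<cdot>, N)\<close>.\<close>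

definition interior_max_case ::
  "(real^'n \<Rightarrow> nat \<Rightarrow> real) \<Rightarrow> (real^'n) set \<Rightarrow> nat \<Rightarrow> (nat \<Rightarrow> real^'n) \<Rightarrow> bool" where
  "interior_max_case f B N0 xs \<longleftrightarrow>
     (\<forall>N\<ge>N0. xs N \<in> interior B) \<and>
     0 < (INF (N, x)\<in>{N0..} \<times> B. min_abs_eigenvalue UNIV (hess (\<lambda>z. f z N) B x)) \<and>
     0 < (INF (N, x)\<in>{N0..} \<times> B. ereal (sqrt \<bar>det (hess (\<lambda>z. f z N) B x)\<bar>)) \<and>
     (SUP (N, x)\<in>{N0..} \<times> B. ereal (mat_norm (hess (\<lambda>z. f z N) B x))) < \<infinity> \<and>
     (SUP (N, x)\<in>{N0..} \<times> B. ereal (trilinear_norm (third_deriv (\<lambda>z. f z N) B x))) < \<infinity>"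

text \<open>
  The coordinate \<open>k\<close> plays the role of \<open>x\<^sub>1\<close>, the remaining ones form \<open>y\<close>. A maximiser over the
  slice \<open>{x \<in> B. x $ k = t}\<close> is a point \<open>(t, y)\<close> with \<open>y\<close> a maximiser over \<open>\<Omega>'(t)\<close>.
\<close>

definition boundary_max_case ::
  "(real^'n \<Rightarrow> nat \<Rightarrow> real) \<Rightarrow> (real^'n) set \<Rightarrow> real \<Rightarrow> 'n \<Rightarrow> nat \<Rightarrow> (nat \<Rightarrow> real^'n) \<Rightarrow> bool" where
  "boundary_max_case f B r k N0 xs \<longleftrightarrow>
     (\<forall>N\<ge>N0. xs N $ k = 0) \<and>
     0 < (INF (N, x)\<in>{N0..} \<times> B. ereal \<bar>grad (\<lambda>z. f z N) B x $ k\<bar>) \<and>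
     0 < (INF (N, x)\<in>{N0..} \<times> B. min_abs_eigenvalue (- {k}) (hess (\<lambda>z. f z N) B x)) \<and>
     0 < (INF (N, x)\<in>{N0..} \<times> B. ereal (sqrt \<bar>sub_det (- {k}) (hess (\<lambda>z. f z N) B x)\<bar>)) \<and>
     (SUP (N, x)\<in>{N0..} \<times> B. ereal (mat_norm (hess (\<lambda>z. f z N) B x))) < \<infinity> \<and>
     (SUP (N, x)\<in>{N0..} \<times> B. ereal (trilinear_norm (third_deriv (\<lambda>z. f z N) B x))) < \<infinity> \<and>
     (\<forall>N\<ge>N0. \<forall>t\<in>{0<..<r}. \<exists>!x. is_arg_max (\<lambda>z. f z N) (\<lambda>z. z \<in> B \<and> z $ k = t) x)"

text \<open>The library's \<open>weak_conv_m\<close> covers measures on the real line only.\<close>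

definition weak_conv_vec :: "(nat \<Rightarrow> (real^'n) measure) \<Rightarrow> (real^'n) measure \<Rightarrow> bool" where
  "weak_conv_vec \<mu> \<nu> \<longleftrightarrow>
     (\<forall>\<phi>::real^'n \<Rightarrow> real. continuous_on UNIV \<phi> \<and> bounded (range \<phi>) \<longrightarrow>
        (\<lambda>n. \<integral>x. \<phi> x \<partial>\<mu> n) \<longlonglongrightarrow> (\<integral>x. \<phi> x \<partial>\<nu>))"

definition mgf :: "'w measure \<Rightarrow> ('w \<Rightarrow> real^'n) \<Rightarrow> real^'n \<Rightarrow> real" where
  "mgf M X \<xi> = (\<integral>\<omega>. exp (\<xi> \<bullet> X \<omega>) \<partial>M)"

end

theory Submission
  imports Defs
begin

text \<open>
  The law of \<open>X N\<close> has a density proportional to \<open>exp (N * f x N)\<close>, and the theorem is a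
  first-moment version of Laplace's method. The moment generating function minus one is the
  expectation of \<open>exp (\<xi> \<bullet> x) - 1\<close>, which is \<open>O(norm x)\<close> near the origin. So no asymptotic
  expansion is needed, only a bound of order \<open>1 / sqrt N + eps N\<close> for the mean of \<open>norm x\<close> over
  the ball, and the same bound, through Markov's inequality, gives convergence in probability.

  The eigenvalue gap of the Hessian (in the boundary case: of its block tangential to the face,
  together with the gap of the normal derivative) forces the negative sign found at the maximiser to
  persist over the whole ball, because the ball is connected. Integrating along segments shows that
  \<open>f\<close> falls quadratically in the free directions, collected in a set \<open>I\<close> of coordinates, and linearly
  in the normal direction, with constants independent of \<open>N\<close> (\<open>anisotropic_growth\<close>). This uses the
  symmetry of the Hessian, which is proved here for derivatives within a ball
  (\<open>hess_symmetric_cball\<close>).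

  Rescaling the coordinates in \<open>I\<close> by \<open>sqrt N\<close> and the others by \<open>N\<close> then bounds the partition
  function from below (\<open>partition_function_lower\<close>) and the moments from above
  (\<open>aniso_moment_bound\<close>) by multiples of the same power of \<open>N\<close>. Outside the ball the height gap
  makes the weight exponentially small against that power. This gives a mean distance \<open>O(1 / sqrt N)\<close>
  from the maximiser \<open>xs N\<close> (\<open>gibbs_moment_bound\<close>). Finally \<open>norm (xs N) = O(eps N)\<close>, since moving
  the maximiser costs a quadratic amount of height while the perturbation \<open>eps N * \<sigma>\<close> offers a linear
  gain (\<open>maximiser_drift\<close>).
\<close>

section \<open>Gradient and Hessian within a set\<close>

lemma has_derivative_grad:
  fixes f :: "real^'n \<Rightarrow> real"
  assumes "f differentiable (at x within S)"
  shows "(f has_derivative (\<lambda>v. grad f S x \<bullet> v)) (at x within S)"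
proof -
  let ?D = "frechet_derivative f (at x within S)"
  have D: "(f has_derivative ?D) (at x within S)"
    using assms frechet_derivative_works by blast
  then have lin: "linear ?D"
    by (rule has_derivative_linear)
  have "?D = (\<lambda>v. grad f S x \<bullet> v)"
  proof
    fix v :: "real^'n"
    have "?D v = ?D (\<Sum>i\<in>UNIV. v $ i *\<^sub>R axis i 1)"
      using basis_expansion[of v] by (simp add: scalar_mult_eq_scaleR)
    also have "\<dots> = grad f S x \<bullet> v"
      by (simp add: linear_sum[OF lin] linear_scale[OF lin] grad_def inner_vec_def mult.commute)
    finally show "?D v = grad f S x \<bullet> v" .
  qed
  with D show ?thesis by simp
qed

lemma has_derivative_hess:
  fixes f :: "real^'n \<Rightarrow> real"
  assumes "grad f S differentiable (at x within S)"
  shows "(grad f S has_derivative (\<lambda>v. hess f S x *v v)) (at x within S)"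
proof -
  let ?D = "frechet_derivative (grad f S) (at x within S)"
  have D: "(grad f S has_derivative ?D) (at x within S)"
    using assms frechet_derivative_works by blast
  then have "linear ?D"
    by (rule has_derivative_linear)
  then have "?D = (\<lambda>v. hess f S x *v v)"
    by (simp add: hess_def fun_eq_iff)
  with D show ?thesis by simp
qed

lemma abs_quadratic_form_le: "\<bar>v \<bullet> (A *v v)\<bar> \<le> mat_norm A * (norm v)\<^sup>2"
  for A :: "real^'n^'n"
proof -
  have "\<bar>v \<bullet> (A *v v)\<bar> \<le> norm v * norm (A *v v)"
    by (rule Cauchy_Schwarz_ineq2)
  also have "\<dots> \<le> norm v * (mat_norm A * norm v)"
    unfolding mat_norm_def
    by (intro mult_left_mono onorm matrix_vector_mul_bounded_linear norm_ge_zero)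
  finally show ?thesis by (simp add: power2_eq_square mult_ac)
qed

lemma has_field_derivative_on_line:
  fixes f :: "real^'n \<Rightarrow> real"
  assumes "f differentiable_on S" and "\<And>s. s \<in> T \<Longrightarrow> x + s *\<^sub>R v \<in> S" and "t \<in> T"
  shows "((\<lambda>s. f (x + s *\<^sub>R v)) has_field_derivative grad f S (x + t *\<^sub>R v) \<bullet> v) (at t within T)"
proof -
  have f: "(f has_derivative (\<lambda>w. grad f S (x + t *\<^sub>R v) \<bullet> w)) (at (x + t *\<^sub>R v) within S)"
    using assms by (intro has_derivative_grad) (auto simp: differentiable_on_def)
  have "((f \<circ> (\<lambda>s. x + s *\<^sub>R v)) has_derivative
      (\<lambda>w. grad f S (x + t *\<^sub>R v) \<bullet> w) \<circ> (\<lambda>s. s *\<^sub>R v)) (at t within T)"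
    by (rule diff_chain_within)
      (auto intro!: derivative_eq_intros has_derivative_subset[OF f] assms)
  then show ?thesis
    by (simp add: has_field_derivative_def o_def mult_commute_abs)
qed

lemma has_field_derivative_grad_on_line:
  fixes f :: "real^'n \<Rightarrow> real"
  assumes "grad f S differentiable_on S" and "\<And>s. s \<in> T \<Longrightarrow> x + s *\<^sub>R v \<in> S" and "t \<in> T"
  shows "((\<lambda>s. grad f S (x + s *\<^sub>R v) \<bullet> w) has_field_derivative
    w \<bullet> (hess f S (x + t *\<^sub>R v) *v v)) (at t within T)"
proof -
  have f: "(grad f S has_derivative (\<lambda>w. hess f S (x + t *\<^sub>R v) *v w)) (at (x + t *\<^sub>R v) within S)"
    using assms by (intro has_derivative_hess) (auto simp: differentiable_on_def)
  have "((grad f S \<circ> (\<lambda>s. x + s *\<^sub>R v)) has_derivative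
      (\<lambda>w. hess f S (x + t *\<^sub>R v) *v w) \<circ> (\<lambda>s. s *\<^sub>R v)) (at t within T)"
    by (rule diff_chain_within)
      (auto intro!: derivative_eq_intros has_derivative_subset[OF f] assms)
  from has_derivative_inner_left[OF this, of w] show ?thesis
    by (simp add: has_field_derivative_def o_def mult_commute_abs inner_commute
        matrix_vector_mult_scaleR)
qed

lemma mvt_field:
  fixes \<phi> :: "real \<Rightarrow> real"
  assumes "a \<le> b" and "\<And>t. t \<in> {a..b} \<Longrightarrow> (\<phi> has_field_derivative \<phi>' t) (at t within {a..b})"
  obtains t where "t \<in> {a..b}" "\<phi> b - \<phi> a = \<phi>' t * (b - a)"
proof -
  have "\<exists>t\<in>{a..b}. \<phi> b - \<phi> a = \<phi>' t * (b - a)"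
    using assms by (intro mvt_very_simple) (auto simp: has_field_derivative_def)
  then show ?thesis using that by blast
qed

text \<open>
  The mean value theorem, applied once in direction \<open>u\<close> and once in direction \<open>v\<close>, writes the second
  difference over a parallelogram as a value of the Hessian form at some point of it. The second
  difference is symmetric in \<open>u\<close> and \<open>v\<close>, so shrinking the parallelogram yields the symmetry of a
  continuous Hessian.
\<close>

lemma second_difference_mvt:
  fixes f :: "real^'n \<Rightarrow> real"
  assumes f: "f differentiable_on S" "grad f S differentiable_on S" and "0 \<le> s"
    and S: "\<And>a b. a \<in> {0..s} \<Longrightarrow> b \<in> {0..s} \<Longrightarrow> x + a *\<^sub>R u + b *\<^sub>R v \<in> S"
  obtains a b where "a \<in> {0..s}" "b \<in> {0..s}"
    "f (x + s *\<^sub>R u + s *\<^sub>R v) - f (x + s *\<^sub>R u) - f (x + s *\<^sub>R v) + f x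
      = s\<^sup>2 * (u \<bullet> (hess f S (x + a *\<^sub>R u + b *\<^sub>R v) *v v))"
proof -
  let ?\<phi> = "\<lambda>t. f ((x + s *\<^sub>R v) + t *\<^sub>R u) - f (x + t *\<^sub>R u)"
  have "(?\<phi> has_field_derivative
      grad f S ((x + s *\<^sub>R v) + t *\<^sub>R u) \<bullet> u - grad f S (x + t *\<^sub>R u) \<bullet> u) (at t within {0..s})"
    if "t \<in> {0..s}" for t
    using that S[of _ s] S[of _ 0] \<open>0 \<le> s\<close>
    by (intro derivative_intros has_field_derivative_on_line[OF f(1)]) (auto simp: add_ac)
  from mvt_field[OF \<open>0 \<le> s\<close> this] obtain a where a: "a \<in> {0..s}" and
    1: "?\<phi> s - ?\<phi> 0 = (grad f S ((x + s *\<^sub>R v) + a *\<^sub>R u) \<bullet> u - grad f S (x + a *\<^sub>R u) \<bullet> u) * s"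
    by auto
  have "((\<lambda>t. grad f S ((x + a *\<^sub>R u) + t *\<^sub>R v) \<bullet> u) has_field_derivative
      u \<bullet> (hess f S ((x + a *\<^sub>R u) + t *\<^sub>R v) *v v)) (at t within {0..s})"
    if "t \<in> {0..s}" for t
    using that S[of a] a by (intro has_field_derivative_grad_on_line[OF f(2)]) auto
  from mvt_field[OF \<open>0 \<le> s\<close> this] obtain b where b: "b \<in> {0..s}" and
    2: "grad f S ((x + a *\<^sub>R u) + s *\<^sub>R v) \<bullet> u - grad f S (x + a *\<^sub>R u) \<bullet> u
      = (u \<bullet> (hess f S ((x + a *\<^sub>R u) + b *\<^sub>R v) *v v)) * s"
    by auto
  show ?thesis
    using that[OF a b] 1 2 by (simp add: power2_eq_square algebra_simps)
qed

lemma hess_symmetric_interior: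
  fixes f :: "real^'n \<Rightarrow> real"
  assumes f: "f differentiable_on S" "grad f S differentiable_on S"
    and cont: "continuous_on S (hess f S)" and x: "x \<in> interior S"
  shows "u \<bullet> (hess f S x *v v) = v \<bullet> (hess f S x *v u)"
proof -
  obtain e where e: "0 < e" "ball x e \<subseteq> S"
    using x mem_interior by blast
  define K where "K = norm u + norm v + 1"
  have K: "0 < K" unfolding K_def by (simp add: add_nonneg_pos)
  \<comment> \<open>Side lengths tending to \<open>0\<close>, small enough for every parallelogram to lie in \<open>ball x e\<close>.\<close>
  define s where "s n = e / (K * (real n + 2))" for n
  have s0: "0 < s n" for n
    using e K by (simp add: s_def)
  have sK: "s n * K < e" for n
  proof -
    have "s n * K = e / (real n + 2)" using K by (simp add: s_def)
    also have "\<dots> < e" using e by (simp add: field_simps add_pos_nonneg)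
    finally show ?thesis .
  qed
  have near: "norm (a *\<^sub>R u + b *\<^sub>R v) \<le> s n * K" if "a \<in> {0..s n}" "b \<in> {0..s n}" for a b n
  proof -
    have "norm (a *\<^sub>R u + b *\<^sub>R v) \<le> a * norm u + b * norm v"
      using that by (intro norm_triangle_le) auto
    also have "\<dots> \<le> s n * norm u + s n * norm v"
      using that by (intro add_mono mult_right_mono) auto
    also have "\<dots> \<le> s n * K" using s0[of n] by (simp add: K_def algebra_simps)
    finally show ?thesis .
  qed
  have inS: "x + (a *\<^sub>R u + b *\<^sub>R v) \<in> S" if "a \<in> {0..s n}" "b \<in> {0..s n}" for a b n
  proof (rule subsetD[OF e(2)])
    have "dist x (x + (a *\<^sub>R u + b *\<^sub>R v)) = norm (a *\<^sub>R u + b *\<^sub>R v)"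
      by (metis add_diff_cancel_left' dist_commute dist_norm)
    also have "\<dots> < e"
      using near[OF that] sK[of n] by simp
    finally show "x + (a *\<^sub>R u + b *\<^sub>R v) \<in> ball x e" by simp
  qed
  define D where "D n = f (x + s n *\<^sub>R u + s n *\<^sub>R v) - f (x + s n *\<^sub>R u) - f (x + s n *\<^sub>R v) + f x" for n
  have "\<exists>z. norm (z - x) \<le> s n * K \<and> z \<in> S \<and> D n = (s n)\<^sup>2 * (u \<bullet> (hess f S z *v v))" for n
  proof (rule second_difference_mvt[OF f, of "s n" x u v])
    fix a b assume ab: "a \<in> {0..s n}" "b \<in> {0..s n}"
      "f (x + s n *\<^sub>R u + s n *\<^sub>R v) - f (x + s n *\<^sub>R u) - f (x + s n *\<^sub>R v) + f x
       = (s n)\<^sup>2 * (u \<bullet> (hess f S (x + a *\<^sub>R u + b *\<^sub>R v) *v v))"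
    then show ?thesis
      using near[OF ab(1,2)] inS[OF ab(1,2)]
      by (intro exI[of _ "x + a *\<^sub>R u + b *\<^sub>R v"]) (simp add: D_def add.assoc)
  qed (use inS[of _ n] s0[of n] in \<open>auto simp: add.assoc\<close>)
  then obtain z where z: "\<And>n. norm (z n - x) \<le> s n * K" "\<And>n. z n \<in> S"
      "\<And>n. D n = (s n)\<^sup>2 * (u \<bullet> (hess f S (z n) *v v))"
    by metis
  have "\<exists>z. norm (z - x) \<le> s n * K \<and> z \<in> S \<and> D n = (s n)\<^sup>2 * (v \<bullet> (hess f S z *v u))" for n
  proof (rule second_difference_mvt[OF f, of "s n" x v u])
    fix b a assume ab: "b \<in> {0..s n}" "a \<in> {0..s n}"
      "f (x + s n *\<^sub>R v + s n *\<^sub>R u) - f (x + s n *\<^sub>R v) - f (x + s n *\<^sub>R u) + f x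
       = (s n)\<^sup>2 * (v \<bullet> (hess f S (x + b *\<^sub>R v + a *\<^sub>R u) *v u))"
    then show ?thesis
      using near[OF ab(2,1)] inS[OF ab(2,1)]
      by (intro exI[of _ "x + b *\<^sub>R v + a *\<^sub>R u"]) (simp add: D_def add_ac)
  next
    show "x + a *\<^sub>R v + b *\<^sub>R u \<in> S" if "a \<in> {0..s n}" "b \<in> {0..s n}" for a b
      using inS[OF that(2,1)] by (simp add: add_ac)
  qed (use s0[of n] in simp)
  then obtain z' where z': "\<And>n. norm (z' n - x) \<le> s n * K" "\<And>n. z' n \<in> S"
      "\<And>n. D n = (s n)\<^sup>2 * (v \<bullet> (hess f S (z' n) *v u))"
    by metis
  have eq: "u \<bullet> (hess f S (z n) *v v) = v \<bullet> (hess f S (z' n) *v u)" for n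
    using z(3)[of n] z'(3)[of n] s0[of n] by simp
  have "(\<lambda>n. e / K * inverse (real (n + 2)) * K) \<longlonglongrightarrow> e / K * 0 * K"
    by (intro tendsto_intros LIMSEQ_ignore_initial_segment lim_inverse_n)
  then have lim0: "(\<lambda>n. s n * K) \<longlonglongrightarrow> 0"
    by (simp add: s_def field_simps)
  have xS: "x \<in> S" using x interior_subset by blast
  have lim: "(\<lambda>n. hess f S (w n)) \<longlonglongrightarrow> hess f S x"
    if w: "\<And>n. norm (w n - x) \<le> s n * K" "\<And>n. w n \<in> S" for w
  proof -
    have "(\<lambda>n. w n - x) \<longlonglongrightarrow> 0"
      by (rule tendsto_norm_zero_cancel, rule real_tendsto_sandwich[OF _ _ tendsto_const lim0])
        (use w in auto)
    then have "w \<longlonglongrightarrow> x" by (simp add: LIM_zero_iff)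
    from continuous_on_tendsto_compose[OF cont this xS] show ?thesis
      using w by simp
  qed
  have c: "continuous_on UNIV (\<lambda>A::real^'n^'n. u \<bullet> (A *v v))" for u v :: "real^'n"
    unfolding matrix_vector_mult_def by (intro continuous_intros)
  have l: "(\<lambda>n. a \<bullet> (hess f S (w n) *v b)) \<longlonglongrightarrow> a \<bullet> (hess f S x *v b)"
    if w: "\<And>n. norm (w n - x) \<le> s n * K" "\<And>n. w n \<in> S" for w a b
    using continuous_on_tendsto_compose[OF c lim[OF w]] by auto
  from l[OF z(1,2), of u v] l[OF z'(1,2), of v u] show ?thesis
    unfolding eq using LIMSEQ_unique by blast
qed

lemma continuous_on_hess_form:
  assumes "continuous_on S (hess f S)"
  shows "continuous_on S (\<lambda>z. u \<bullet> (hess f S z *v v))"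
  unfolding matrix_vector_mult_def using assms by (intro continuous_intros)

text \<open>
  On the boundary sphere, where only derivatives within the ball exist, symmetry follows from the
  interior by continuity of the Hessian.
\<close>

lemma hess_symmetric_cball:
  fixes f :: "real^'n \<Rightarrow> real"
  assumes f: "thrice_differentiable_on f (cball 0 r)" and "0 < r" and x: "x \<in> cball 0 r"
  shows "u \<bullet> (hess f (cball 0 r) x *v v) = v \<bullet> (hess f (cball 0 r) x *v u)"
proof -
  let ?B = "cball 0 r :: (real^'n) set"
  have d: "f differentiable_on ?B" "grad f ?B differentiable_on ?B"
    and cont: "continuous_on ?B (hess f ?B)"
    using f by (auto simp: thrice_differentiable_on_def differentiable_imp_continuous_on)
  have "u \<bullet> (hess f ?B x *v v) - v \<bullet> (hess f ?B x *v u) = 0"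
  proof (rule continuous_constant_on_closure[where S = "ball 0 r" and
        f = "\<lambda>x. u \<bullet> (hess f ?B x *v v) - v \<bullet> (hess f ?B x *v u)"])
    show "continuous_on (closure (ball 0 r)) (\<lambda>x. u \<bullet> (hess f ?B x *v v) - v \<bullet> (hess f ?B x *v u))"
      using \<open>0 < r\<close> by (simp add: continuous_on_diff continuous_on_hess_form[OF cont])
    show "u \<bullet> (hess f ?B y *v v) - v \<bullet> (hess f ?B y *v u) = 0" if "y \<in> ball 0 r" for y
      using hess_symmetric_interior[OF d cont, of y] that by simp
    show "x \<in> closure (ball 0 r)" using x \<open>0 < r\<close> by simp
  qed
  then show ?thesis by simp
qed

lemma taylor2_upper_unit:
  fixes \<phi> :: "real \<Rightarrow> real"
  assumes 1: "\<And>t. t \<in> {0..1} \<Longrightarrow> (\<phi> has_field_derivative \<phi>' t) (at t within {0..1})"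
    and 2: "\<And>t. t \<in> {0..1} \<Longrightarrow> (\<phi>' has_field_derivative \<phi>'' t) (at t within {0..1})"
    and le: "\<And>t. t \<in> {0..1} \<Longrightarrow> \<phi>'' t \<le> a"
  shows "\<phi> 1 \<le> \<phi> 0 + \<phi>' 0 + a / 2"
proof -
  have slope: "\<phi>' t \<le> \<phi>' 0 + a * t" if t: "t \<in> {0..1}" for t
  proof -
    have "(\<phi>' has_field_derivative \<phi>'' s) (at s within {0..t})" if "s \<in> {0..t}" for s
      using that t by (intro DERIV_subset[OF 2]) auto
    then obtain s where "s \<in> {0..t}" "\<phi>' t - \<phi>' 0 = \<phi>'' s * (t - 0)"
      using mvt_field[of 0 t \<phi>' \<phi>''] t by auto
    moreover have "\<phi>'' s * t \<le> a * t"
      using \<open>s \<in> {0..t}\<close> t le[of s] by (intro mult_right_mono) auto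
    ultimately show ?thesis by simp
  qed
  let ?\<psi> = "\<lambda>t. \<phi> t - \<phi>' 0 * t - a / 2 * t\<^sup>2"
  have "(?\<psi> has_field_derivative \<phi>' t - \<phi>' 0 - a * t) (at t within {0..1})" if "t \<in> {0..1}" for t
    by (auto intro!: derivative_eq_intros 1 that)
  then obtain t where "t \<in> {0..1}" "?\<psi> 1 - ?\<psi> 0 = (\<phi>' t - \<phi>' 0 - a * t) * (1 - 0)"
    using mvt_field[of 0 1 ?\<psi> "\<lambda>t. \<phi>' t - \<phi>' 0 - a * t"] by auto
  with slope[of t] show ?thesis by simp
qed

text \<open>
  Second-order Taylor bounds for a convex \<open>S\<close>: a bound on the Hessian form in the single direction
  \<open>v\<close> is all that is needed.
\<close>

lemma taylor2_segment:
  fixes f :: "real^'n \<Rightarrow> real"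
  assumes f: "f differentiable_on S" "grad f S differentiable_on S"
    and "convex S" and x: "x \<in> S" "x + v \<in> S"
  shows taylor2_upper: "(\<And>z. z \<in> S \<Longrightarrow> v \<bullet> (hess f S z *v v) \<le> a) \<Longrightarrow>
      f (x + v) \<le> f x + grad f S x \<bullet> v + a / 2"
    and taylor2_lower: "(\<And>z. z \<in> S \<Longrightarrow> a \<le> v \<bullet> (hess f S z *v v)) \<Longrightarrow>
      f x + grad f S x \<bullet> v + a / 2 \<le> f (x + v)"
proof -
  have S: "x + s *\<^sub>R v \<in> S" if "s \<in> {0..1}" for s
  proof -
    have "x + s *\<^sub>R v = (1 - s) *\<^sub>R x + s *\<^sub>R (x + v)" by (simp add: algebra_simps)
    then show ?thesis using convexD_alt[OF \<open>convex S\<close> x, of s] that by simp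
  qed
  note d = has_field_derivative_on_line[OF f(1) S] has_field_derivative_grad_on_line[OF f(2) S]
  show "f (x + v) \<le> f x + grad f S x \<bullet> v + a / 2"
    if "\<And>z. z \<in> S \<Longrightarrow> v \<bullet> (hess f S z *v v) \<le> a"
    using taylor2_upper_unit[OF d(1) d(2), of a] that S by simp
  show "f x + grad f S x \<bullet> v + a / 2 \<le> f (x + v)"
    if "\<And>z. z \<in> S \<Longrightarrow> a \<le> v \<bullet> (hess f S z *v v)"
    using taylor2_upper_unit[OF d(1)[THEN DERIV_minus] d(2)[THEN DERIV_minus], of "- a"] that S by simp
qed

text \<open>
  The necessary conditions of first and second order, for a maximum along one line only.
\<close>

lemma derivatives_at_directional_max:
  fixes f :: "real^'n \<Rightarrow> real"
  assumes f: "f differentiable_on S" "grad f S differentiable_on S" and x: "x \<in> interior S"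
    and max: "\<And>t. x + t *\<^sub>R v \<in> S \<Longrightarrow> f (x + t *\<^sub>R v) \<le> f x"
  shows "grad f S x \<bullet> v = 0" and "v \<bullet> (hess f S x *v v) \<le> 0"
proof -
  obtain e where e: "0 < e" "ball x e \<subseteq> S"
    using x mem_interior by blast
  define d where "d = e / (norm v + 1)"
  have d: "0 < d" using e by (simp add: d_def add_nonneg_pos)
  have S: "x + t *\<^sub>R v \<in> S" if "\<bar>t\<bar> < d" for t
  proof -
    have "norm (t *\<^sub>R v) \<le> \<bar>t\<bar> * (norm v + 1)" by (simp add: mult_left_mono)
    also have "\<dots> < d * (norm v + 1)" using that by (intro mult_strict_right_mono) (auto simp: add_nonneg_pos)
    also have "\<dots> = e" by (simp add: d_def add_nonneg_eq_0_iff)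
    finally show ?thesis using e(2) by (auto simp: dist_norm subset_iff)
  qed
  let ?T = "{-d<..<d}"
  have S': "x + s *\<^sub>R v \<in> S" if "s \<in> ?T" for s
    using S that by (simp add: abs_less_iff minus_less_iff)
  have 1: "((\<lambda>s. f (x + s *\<^sub>R v)) has_field_derivative grad f S (x + t *\<^sub>R v) \<bullet> v) (at t)"
    if "t \<in> ?T" for t
    using has_field_derivative_on_line[OF f(1) S' that] that
    by (simp only: at_within_open[OF that open_greaterThanLessThan])
  have "0 \<in> ?T" using d by simp
  have 2: "((\<lambda>s. grad f S (x + s *\<^sub>R v) \<bullet> v) has_field_derivative v \<bullet> (hess f S x *v v)) (at 0)"
    using has_field_derivative_grad_on_line[OF f(2) S' \<open>0 \<in> ?T\<close>, of v]
    by (simp only: at_within_open[OF \<open>0 \<in> ?T\<close> open_greaterThanLessThan]) simp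
  show g0: "grad f S x \<bullet> v = 0"
    using DERIV_local_max[OF 1[OF \<open>0 \<in> ?T\<close>] d] max S by simp
  show "v \<bullet> (hess f S x *v v) \<le> 0"
  proof (rule ccontr)
    \<comment> \<open>A positive second derivative makes the slope positive to the right of the critical point, so
      \<open>f\<close> would exceed its maximum there.\<close>
    assume "\<not> ?thesis"
    then obtain d' where d': "0 < d'" "\<And>h. 0 < h \<Longrightarrow> h < d' \<Longrightarrow> 0 < grad f S (x + h *\<^sub>R v) \<bullet> v"
      using DERIV_pos_inc_right[OF 2] g0 by auto
    define h where "h = min d d' / 2"
    have h: "0 < h" "h < d" "h < d'" using d d' by (auto simp: h_def)
    obtain t where "0 < t" "t < h" "f (x + h *\<^sub>R v) - f (x + 0 *\<^sub>R v) = (h - 0) * (grad f S (x + t *\<^sub>R v) \<bullet> v)"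
      using MVT2[of 0 h "\<lambda>s. f (x + s *\<^sub>R v)" "\<lambda>t. grad f S (x + t *\<^sub>R v) \<bullet> v"] h 1 by auto
    moreover have "0 < h * (grad f S (x + t *\<^sub>R v) \<bullet> v)"
      using \<open>0 < t\<close> \<open>t < h\<close> h by (intro mult_pos_pos d') auto
    ultimately show False
      using max[of h] S[of h] h by simp
  qed
qed

section \<open>Uniform negativity of the Hessian form\<close>

text \<open>
  The coordinate subspace of the vectors that vanish outside \<open>I\<close>. The
  restriction to it of the quadratic form of a matrix is the form of the principal submatrix with
  rows and columns in \<open>I\<close>.
\<close>

definition supported_on :: "'n set \<Rightarrow> real^'n \<Rightarrow> bool" where
  "supported_on I v \<longleftrightarrow> (\<forall>i. i \<notin> I \<longrightarrow> v $ i = 0)"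

text \<open>
  The maximum of the form on the unit sphere of the subspace is an eigenvalue of the principal
  submatrix. It is nonpositive, and the gap around zero pushes it down to \<open>- \<kappa>\<close>.
\<close>

lemma sub_eigenvalue_gap:
  fixes H :: "real^'n^'n"
  assumes sym: "\<And>u v. u \<bullet> (H *v v) = v \<bullet> (H *v u)"
    and neg: "\<And>v. supported_on I v \<Longrightarrow> v \<bullet> (H *v v) \<le> 0"
    and gap: "\<And>l. l \<in> sub_eigenvalues I H \<Longrightarrow> \<kappa> \<le> \<bar>l\<bar>"
    and v: "supported_on I v"
  shows "v \<bullet> (H *v v) \<le> - \<kappa> * (norm v)\<^sup>2"
proof (cases "v = 0")
  case False
  let ?S = "sphere 0 1 \<inter> {v. supported_on I v}"
  have "{v. supported_on I v} = (\<Inter>i\<in>-I. {v. v $ i = 0})"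
    by (auto simp: supported_on_def)
  then have "closed {v :: real^'n. supported_on I v}"
    by (auto intro!: closed_INT closed_Collect_eq continuous_intros)
  then have "compact ?S" by (intro compact_Int_closed) auto
  moreover have unit: "(1 / norm w) *\<^sub>R w \<in> ?S" if "w \<noteq> 0" "supported_on I w" for w
    using that by (auto simp: supported_on_def)
  then have "?S \<noteq> {}" using False v by blast
  moreover have "continuous_on ?S (\<lambda>w. w \<bullet> (H *v w))"
    by (intro continuous_intros linear_continuous_on matrix_vector_mul_bounded_linear)
  ultimately obtain w0 where w0: "w0 \<in> ?S" and max: "\<And>w. w \<in> ?S \<Longrightarrow> w \<bullet> (H *v w) \<le> w0 \<bullet> (H *v w0)"
    using continuous_attains_sup[of ?S "\<lambda>w. w \<bullet> (H *v w)"] by blast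
  define \<mu> where "\<mu> = w0 \<bullet> (H *v w0)"
  have ray: "w \<bullet> (H *v w) \<le> \<mu> * (norm w)\<^sup>2" if "supported_on I w" for w
  proof (cases "w = 0")
    case w: False
    have "((1 / norm w) *\<^sub>R w) \<bullet> (H *v ((1 / norm w) *\<^sub>R w)) \<le> \<mu>"
      unfolding \<mu>_def using max unit[OF w that] by blast
    then show ?thesis
      using w by (simp add: matrix_vector_mult_scaleR field_simps power2_eq_square)
  qed simp
  \<comment> \<open>Criticality of the maximiser: \<open>\<mu> * (norm w)\<^sup>2 - w \<bullet> (H *v w)\<close> is a nonnegative form vanishing
    at \<open>w0\<close>, so its polarisation with \<open>w0\<close> vanishes too.\<close>
  have "w \<bullet> (H *v w0) = \<mu> * (w \<bullet> w0)" if w: "supported_on I w" for w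
  proof -
    define b where "b = \<mu> * (w \<bullet> w0) - w \<bullet> (H *v w0)"
    define q where "q = \<mu> * (w \<bullet> w) - w \<bullet> (H *v w)"
    have nonneg: "0 \<le> 2 * t * b + t\<^sup>2 * q" for t
    proof -
      have s: "supported_on I (w0 + t *\<^sub>R w)"
        using w0 w by (auto simp: supported_on_def)
      have "w0 \<bullet> w0 = 1" using w0 by (simp add: dot_square_norm)
      then have "\<mu> * ((w0 + t *\<^sub>R w) \<bullet> (w0 + t *\<^sub>R w)) - (w0 + t *\<^sub>R w) \<bullet> (H *v (w0 + t *\<^sub>R w))
          = 2 * t * b + t\<^sup>2 * q"
        using sym[of w0 w] unfolding b_def q_def \<mu>_def
        by (simp add: matrix_vector_right_distrib matrix_vector_mult_scaleR inner_commute
            algebra_simps power2_eq_square)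
      then show ?thesis using ray[OF s] by (simp add: power2_norm_eq_inner)
    qed
    have "b = 0"
    proof (rule ccontr)
      assume "b \<noteq> 0"
      \<comment> \<open>A small step against the sign of \<open>b\<close>; the summand \<open>1\<close> keeps the denominator positive when \<open>q = 0\<close>.\<close>
      define p where "p = \<bar>q\<bar> + 1"
      have p: "0 < p" "q < p" by (auto simp: p_def)
      define t where "t = - b / p"
      have "2 * t * b + t\<^sup>2 * q = b\<^sup>2 / p * (q / p - 2)"
        using p(1) by (simp add: t_def power2_eq_square field_simps)
      moreover have "b\<^sup>2 / p > 0" using \<open>b \<noteq> 0\<close> p by simp
      moreover have "q / p - 2 < 0" using p by (simp add: field_simps)
      ultimately show False using nonneg[of t] by (smt (verit) mult_pos_neg)
    qed
    then show ?thesis by (simp add: b_def)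
  qed
  note crit = this
  have "(\<Sum>j\<in>I. H $ i $ j * w0 $ j) = \<mu> * w0 $ i" if "i \<in> I" for i
  proof -
    have "(\<Sum>j\<in>I. H $ i $ j * w0 $ j) = (\<Sum>j\<in>UNIV. H $ i $ j * w0 $ j)"
      using w0 by (intro sum.mono_neutral_left) (auto simp: supported_on_def)
    also have "\<dots> = axis i 1 \<bullet> (H *v w0)"
      by (simp add: inner_axis' matrix_vector_mult_def)
    also have "\<dots> = \<mu> * w0 $ i"
    proof -
      have "supported_on I (axis i 1 :: real^'n)"
        using that by (auto simp: supported_on_def axis_def)
      from crit[OF this] show ?thesis by (simp add: inner_axis')
    qed
    finally show ?thesis .
  qed
  moreover have "w0 \<noteq> 0" using w0 by auto
  ultimately have "\<mu> \<in> sub_eigenvalues I H"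
    using w0 unfolding sub_eigenvalues_def supported_on_def by blast
  moreover have "\<mu> \<le> 0" using neg w0 by (simp add: \<mu>_def)
  ultimately have "\<mu> \<le> - \<kappa>" using gap by fastforce
  then show ?thesis
    using ray[OF v] mult_right_mono[of \<mu> "- \<kappa>" "(norm v)\<^sup>2"] by simp
qed simp

lemma abs_quadratic_form_le_norm: "\<bar>v \<bullet> (A *v v)\<bar> \<le> CARD('n) * norm A * (norm v)\<^sup>2"
  for A :: "real^'n^'n"
proof -
  have "\<bar>v \<bullet> (A *v v)\<bar> = \<bar>\<Sum>i\<in>UNIV. v $ i * (A $ i \<bullet> v)\<bar>"
    by (simp add: inner_vec_def matrix_vector_mult_def)
  also have "\<dots> \<le> (\<Sum>i\<in>UNIV. \<bar>v $ i * (A $ i \<bullet> v)\<bar>)"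
    by (rule sum_abs)
  also have "\<dots> \<le> (\<Sum>i\<in>(UNIV :: 'n set). norm v * (norm A * norm v))"
  proof (rule sum_mono)
    fix i
    have "\<bar>A $ i \<bullet> v\<bar> \<le> norm (A $ i) * norm v" by (rule Cauchy_Schwarz_ineq2)
    also have "\<dots> \<le> norm A * norm v" by (intro mult_right_mono Finite_Cartesian_Product.norm_nth_le) auto
    finally show "\<bar>v $ i * (A $ i \<bullet> v)\<bar> \<le> norm v * (norm A * norm v)"
      unfolding abs_mult by (intro mult_mono component_le_norm_cart) auto
  qed
  finally show ?thesis by (simp add: power2_eq_square mult_ac)
qed

text \<open>
  By the eigenvalue gap a Hessian form that is nonpositive is already at most \<open>- \<kappa> * (norm v)\<^sup>2\<close>. The
  set of points of the ball where this holds is therefore both closed and open, hence it is the whole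
  ball as soon as it is nonempty.
\<close>

lemma hess_form_negative_propagates:
  fixes f :: "real^'n \<Rightarrow> real"
  assumes f: "thrice_differentiable_on f (cball 0 r)" and "0 < r" and "0 < \<kappa>"
    and gap: "\<And>x l. x \<in> cball 0 r \<Longrightarrow> l \<in> sub_eigenvalues I (hess f (cball 0 r) x) \<Longrightarrow> \<kappa> \<le> \<bar>l\<bar>"
    and x0: "x0 \<in> cball 0 r"
      "\<And>v. supported_on I v \<Longrightarrow> v \<bullet> (hess f (cball 0 r) x0 *v v) \<le> 0"
    and x: "x \<in> cball 0 r" and v: "supported_on I v"
  shows "v \<bullet> (hess f (cball 0 r) x *v v) \<le> - \<kappa> * (norm v)\<^sup>2"
proof -
  let ?B = "cball 0 r :: (real^'n) set"
  let ?H = "hess f ?B"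
  have cont: "continuous_on ?B ?H"
    using f by (auto simp: thrice_differentiable_on_def differentiable_imp_continuous_on)
  note sym = hess_symmetric_cball[OF f \<open>0 < r\<close>]
  define T where "T = {x \<in> ?B. \<forall>v. supported_on I v \<longrightarrow> v \<bullet> (?H x *v v) \<le> - \<kappa> * (norm v)\<^sup>2}"
  have T: "x \<in> T" if "x \<in> ?B" "\<And>v. supported_on I v \<Longrightarrow> v \<bullet> (?H x *v v) \<le> 0" for x
    using that sub_eigenvalue_gap[of "?H x" I \<kappa>] sym[OF that(1)] gap[OF that(1)]
    by (auto simp: T_def)
  have "T = ?B \<inter> (\<Inter>v\<in>{v. supported_on I v}. {x \<in> ?B. v \<bullet> (?H x *v v) \<le> - \<kappa> * (norm v)\<^sup>2})"
    by (auto simp: T_def)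
  moreover have "closed {x \<in> ?B. v \<bullet> (?H x *v v) \<le> - \<kappa> * (norm v)\<^sup>2}" for v
    by (intro continuous_on_closed_Collect_le continuous_on_hess_form cont continuous_intros closed_cball)
  ultimately have "closed T" by (auto intro!: closed_Int closed_INT)
  then have "closedin (top_of_set ?B) T"
    by (intro closed_subset) (auto simp: T_def)
  moreover have "openin (top_of_set ?B) T"
    unfolding openin_euclidean_subtopology_iff
  proof safe
    fix x assume "x \<in> T"
    then have xB: "x \<in> ?B" by (simp add: T_def)
    define n where "n = real CARD('n)"
    have n: "0 < n" by (simp add: n_def)
    obtain d where d: "0 < d" "\<And>y. y \<in> ?B \<Longrightarrow> dist y x < d \<Longrightarrow> dist (?H y) (?H x) < \<kappa> / n"
      using cont xB \<open>0 < \<kappa>\<close> n unfolding continuous_on_iff by (metis divide_pos_pos)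
    have "y \<in> T" if "y \<in> ?B" "dist y x < d" for y
    proof (rule T[OF that(1)])
      fix v :: "real^'n" assume v: "supported_on I v"
      have "v \<bullet> (?H y *v v) = v \<bullet> (?H x *v v) + v \<bullet> ((?H y - ?H x) *v v)"
        by (simp add: matrix_vector_mult_diff_rdistrib inner_diff_right)
      also have "v \<bullet> (?H x *v v) \<le> - \<kappa> * (norm v)\<^sup>2"
        using \<open>x \<in> T\<close> v by (simp add: T_def)
      also have "v \<bullet> ((?H y - ?H x) *v v) \<le> n * norm (?H y - ?H x) * (norm v)\<^sup>2"
        unfolding n_def using abs_quadratic_form_le_norm[of v "?H y - ?H x"] by linarith
      also have "\<dots> \<le> \<kappa> * (norm v)\<^sup>2"
        using d(2)[OF that] n by (intro mult_right_mono) (auto simp: dist_norm field_simps)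
      finally show "v \<bullet> (?H y *v v) \<le> 0" by simp
    qed
    with d show "\<exists>e>0. \<forall>x'\<in>?B. dist x' x < e \<longrightarrow> x' \<in> T" by blast
  qed (simp add: T_def)
  moreover have "x0 \<in> T" using T x0 by blast
  ultimately have "T = ?B"
    using connected_clopen[of ?B] connected_cball[of "0 :: real^'n" r] by blast
  then show ?thesis using x v by (auto simp: T_def)
qed

section \<open>Growth away from a maximum\<close>

text \<open>
  The loss of height near the maximum, up to constants: quadratic in the coordinates of \<open>I\<close>,
  linear in the others.
\<close>

definition aniso :: "'n set \<Rightarrow> real^'n \<Rightarrow> real" where
  "aniso I v = (\<Sum>i\<in>UNIV. if i \<in> I then (v $ i)\<^sup>2 else \<bar>v $ i\<bar>)"

lemma aniso_UNIV: "aniso UNIV v = (norm v)\<^sup>2"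
  unfolding power2_norm_eq_inner by (simp add: aniso_def inner_vec_def power2_eq_square)

lemma norm_split_component: "(norm v)\<^sup>2 = (norm (v - (v $ k) *\<^sub>R axis k 1))\<^sup>2 + (v $ k)\<^sup>2"
  for v :: "real^'n"
  unfolding power2_norm_eq_inner
  by (simp add: inner_diff inner_axis inner_axis' power2_eq_square algebra_simps)

lemma aniso_Compl_single: "aniso (- {k}) v = (norm (v - (v $ k) *\<^sub>R axis k 1))\<^sup>2 + \<bar>v $ k\<bar>"
proof -
  have "aniso (- {k}) v + (v $ k)\<^sup>2 = (norm v)\<^sup>2 + \<bar>v $ k\<bar>"
    unfolding power2_norm_eq_inner
    by (simp add: aniso_def inner_vec_def power2_eq_square sum.remove[of UNIV k])
  with norm_split_component[of v k] show ?thesis by simp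
qed

text \<open>
  At an interior maximum the gradient vanishes and the Hessian is negative, uniformly over the ball.
\<close>

lemma growth_interior_max:
  fixes f :: "real^'n \<Rightarrow> real"
  assumes f: "thrice_differentiable_on f (cball 0 r)" and "0 < r" and "0 < \<kappa>"
    and gap: "\<And>x l. x \<in> cball 0 r \<Longrightarrow> l \<in> sub_eigenvalues UNIV (hess f (cball 0 r) x) \<Longrightarrow> \<kappa> \<le> \<bar>l\<bar>"
    and K: "\<And>x. x \<in> cball 0 r \<Longrightarrow> mat_norm (hess f (cball 0 r) x) \<le> K"
    and x0: "x0 \<in> ball 0 r" and max: "\<And>x. x \<in> cball 0 r \<Longrightarrow> f x \<le> f x0"
    and x: "x \<in> cball 0 r"
  shows "f x \<le> f x0 - \<kappa> / 2 * aniso UNIV (x - x0)" and "f x0 - K / 2 * aniso UNIV (x - x0) \<le> f x"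
proof -
  let ?B = "cball 0 r :: (real^'n) set"
  have d: "f differentiable_on ?B" "grad f ?B differentiable_on ?B"
    using f by (auto simp: thrice_differentiable_on_def)
  have i: "x0 \<in> interior ?B" "x0 \<in> ?B" using x0 by auto
  define v where "v = x - x0"
  have g: "grad f ?B x0 \<bullet> w = 0" and h: "w \<bullet> (hess f ?B x0 *v w) \<le> 0" for w
    using derivatives_at_directional_max[OF d i(1), of w] max by auto
  have xv: "x0 + v \<in> ?B" "x0 + v = x" using x by (auto simp: v_def)
  have "v \<bullet> (hess f ?B z *v v) \<le> - \<kappa> * (norm v)\<^sup>2" if "z \<in> ?B" for z
    using hess_form_negative_propagates[OF f \<open>0 < r\<close> \<open>0 < \<kappa>\<close> gap i(2) h that]
    by (simp add: supported_on_def)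
  from taylor2_upper[OF d convex_cball i(2) xv(1) this] show "f x \<le> f x0 - \<kappa> / 2 * aniso UNIV (x - x0)"
    using g[of v] xv(2) by (simp add: aniso_UNIV flip: v_def)
  have "- K * (norm v)\<^sup>2 \<le> v \<bullet> (hess f ?B z *v v)" if "z \<in> ?B" for z
    using abs_quadratic_form_le[of v "hess f ?B z"] mult_right_mono[OF K[OF that], of "(norm v)\<^sup>2"] by simp
  from taylor2_lower[OF d convex_cball i(2) xv(1) this] show "f x0 - K / 2 * aniso UNIV (x - x0) \<le> f x"
    using g[of v] xv(2) by (simp add: aniso_UNIV flip: v_def)
qed

text \<open>
  At a maximum \<open>x0\<close> over the half ball \<open>x $ k \<ge> 0\<close> that lies on the face \<open>x $ k = 0\<close>, the function
  falls linearly along axis \<open>k\<close> and quadratically within the face. The upper bound is obtained by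
  first moving from \<open>x\<close> to its projection \<open>y\<close> onto the face and then from \<open>y\<close> to \<open>x0\<close>.
\<close>

lemma growth_boundary_max:
  fixes f :: "real^'n \<Rightarrow> real"
  assumes f: "thrice_differentiable_on f (cball 0 r)" and "0 < r" and "0 < \<kappa>"
    and gap: "\<And>x l. x \<in> cball 0 r \<Longrightarrow> l \<in> sub_eigenvalues (- {k}) (hess f (cball 0 r) x) \<Longrightarrow> \<kappa> \<le> \<bar>l\<bar>"
    and slope: "\<And>x. x \<in> cball 0 r \<Longrightarrow> \<kappa> \<le> \<bar>grad f (cball 0 r) x $ k\<bar>"
    and K: "\<And>x. x \<in> cball 0 r \<Longrightarrow> mat_norm (hess f (cball 0 r) x) \<le> K"
      "\<And>x. x \<in> cball 0 r \<Longrightarrow> norm (grad f (cball 0 r) x) \<le> K"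
    and x0: "x0 \<in> ball 0 r" "x0 $ k = 0"
    and max: "\<And>x. x \<in> cball 0 r \<Longrightarrow> 0 \<le> x $ k \<Longrightarrow> f x \<le> f x0"
    and x: "x \<in> cball 0 r" "0 \<le> x $ k"
  shows "f x \<le> f x0 - \<kappa> / 2 * aniso (- {k}) (x - x0)"
    and "x $ k \<le> 1 \<Longrightarrow> f x0 - 3 * K / 2 * aniso (- {k}) (x - x0) \<le> f x"
proof -
  let ?B = "cball 0 r :: (real^'n) set"
  have d: "f differentiable_on ?B" "grad f ?B differentiable_on ?B"
    using f by (auto simp: thrice_differentiable_on_def)
  have i: "x0 \<in> interior ?B" "x0 \<in> ?B" using x0 by auto
  define t where "t = x $ k"
  define y where "y = x - t *\<^sub>R axis k 1"
  define w where "w = y - x0"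
  have t: "0 \<le> t" "(x - x0) $ k = t" using x x0 by (auto simp: t_def)
  have w: "w = (x - x0) - (x - x0) $ k *\<^sub>R axis k 1"
    using t by (simp add: w_def y_def)
  have ws: "supported_on (- {k}) w" by (simp add: w supported_on_def axis_def)
  have aniso: "aniso (- {k}) (x - x0) = (norm w)\<^sup>2 + t"
    using aniso_Compl_single[of k "x - x0"] t w by simp
  have "norm y \<le> norm x"
    by (rule norm_le_componentwise_cart) (simp add: y_def t_def axis_def)
  then have yB: "y \<in> ?B" using x by simp
  \<comment> \<open>In the directions of \<open>-{k}\<close> the point \<open>x0\<close> is a free maximum.\<close>
  have gh: "grad f ?B x0 \<bullet> v = 0" "v \<bullet> (hess f ?B x0 *v v) \<le> 0" if "supported_on (- {k}) v" for v
    using derivatives_at_directional_max[OF d i(1), of v] max x0 that by (auto simp: supported_on_def)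
  have "w \<bullet> (hess f ?B z *v w) \<le> - \<kappa> * (norm w)\<^sup>2" if "z \<in> ?B" for z
    using hess_form_negative_propagates[OF f \<open>0 < r\<close> \<open>0 < \<kappa>\<close> gap i(2) gh(2) that ws] by simp
  from taylor2_upper[OF d convex_cball i(2) _ this] have fy: "f y \<le> f x0 - \<kappa> / 2 * (norm w)\<^sup>2"
    using gh(1)[OF ws] yB by (simp add: w_def)
  \<comment> \<open>Otherwise \<open>f\<close> would increase from \<open>x0\<close> into the half ball.\<close>
  have "grad f ?B x0 $ k \<le> 0"
  proof (rule ccontr)
    assume "\<not> ?thesis"
    moreover obtain e where e: "0 < e" "ball x0 e \<subseteq> ?B"
      using i(1) mem_interior by blast
    have S: "x0 + s *\<^sub>R axis k 1 \<in> ?B" if "s \<in> {0..e/2}" for s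
      by (rule subsetD[OF e(2)]) (use that e in \<open>simp add: dist_norm norm_minus_commute\<close>)
    have "((\<lambda>s. f (x0 + s *\<^sub>R axis k 1)) has_field_derivative grad f ?B (x0 + 0 *\<^sub>R axis k 1) \<bullet> axis k 1)
        (at 0 within {0..e/2})"
      by (rule has_field_derivative_on_line[OF d(1) S]) (use e in auto)
    from has_real_derivative_pos_inc_right[OF this] calculation
    obtain d where "0 < d" "\<And>h. 0 < h \<Longrightarrow> h \<in> {0..e/2} \<Longrightarrow> h < d \<Longrightarrow> f x0 < f (x0 + h *\<^sub>R axis k 1)"
      by (auto simp: inner_axis)
    then have "f x0 < f (x0 + (min (e/2) (d/2)) *\<^sub>R axis k 1)"
      using e by simp
    moreover have "f (x0 + (min (e/2) (d/2)) *\<^sub>R axis k 1) \<le> f x0"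
      using max S[of "min (e/2) (d/2)"] e \<open>0 < d\<close> x0 by simp
    ultimately show False by simp
  qed
  \<comment> \<open>The derivative in direction \<open>k\<close> omits a neighbourhood of \<open>0\<close> and the ball is connected, so its
    sign at \<open>x0\<close> is its sign everywhere.\<close>
  have g: "grad f ?B z $ k \<le> - \<kappa>" if z: "z \<in> ?B" for z
  proof (rule ccontr)
    assume "\<not> ?thesis"
    with slope[OF z] have "0 \<le> grad f ?B z $ k" by linarith
    moreover have "connected (grad f ?B ` ?B)"
      using d by (intro connected_continuous_image differentiable_imp_continuous_on) auto
    ultimately obtain z' where "z' \<in> ?B" "grad f ?B z' $ k = 0"
      using connected_ivt_component_cart[of "grad f ?B ` ?B" "grad f ?B x0" "grad f ?B z" k 0]
        \<open>grad f ?B x0 $ k \<le> 0\<close> z i by auto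
    with slope[of z'] \<open>0 < \<kappa>\<close> show False by simp
  qed
  have S: "y + s *\<^sub>R axis k 1 \<in> ?B" if "s \<in> {0..t}" for s
  proof -
    have "norm (y + s *\<^sub>R axis k 1) \<le> norm x"
      by (rule norm_le_componentwise_cart) (use that in \<open>simp add: y_def t_def axis_def\<close>)
    then show ?thesis using x by simp
  qed
  obtain s where s: "s \<in> {0..t}"
    "f (y + t *\<^sub>R axis k 1) - f (y + 0 *\<^sub>R axis k 1) = grad f ?B (y + s *\<^sub>R axis k 1) \<bullet> axis k 1 * (t - 0)"
    using mvt_field[OF t(1) has_field_derivative_on_line[OF d(1) S]] by blast
  have "(grad f ?B (y + s *\<^sub>R axis k 1) \<bullet> axis k 1) * t \<le> - \<kappa> * t"
    using g[OF S[OF s(1)]] t by (intro mult_right_mono) (auto simp: inner_axis)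
  with s have "f x \<le> f y - \<kappa> * t" by (simp add: y_def)
  moreover have "\<kappa> / 2 * t \<le> \<kappa> * t" using t \<open>0 < \<kappa>\<close> by simp
  ultimately show "f x \<le> f x0 - \<kappa> / 2 * aniso (- {k}) (x - x0)"
    using fy unfolding aniso distrib_left by linarith
  show "f x0 - 3 * K / 2 * aniso (- {k}) (x - x0) \<le> f x" if "x $ k \<le> 1"
  proof -
    define v where "v = x - x0"
    have v: "v = w + t *\<^sub>R axis k 1" using t w by (simp add: v_def)
    have K0: "0 \<le> K" using K(2)[OF i(2)] norm_ge_zero order_trans by blast
    have "- K * (norm v)\<^sup>2 \<le> v \<bullet> (hess f ?B z *v v)" if "z \<in> ?B" for z
      using abs_quadratic_form_le[of v "hess f ?B z"] mult_right_mono[OF K(1)[OF that], of "(norm v)\<^sup>2"] by simp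
    from taylor2_lower[OF d convex_cball i(2) _ this] x
    have "f x0 + grad f ?B x0 \<bullet> v - K / 2 * (norm v)\<^sup>2 \<le> f x" by (simp add: v_def)
    moreover have "- (K * t) \<le> grad f ?B x0 \<bullet> v"
    proof -
      have "\<bar>grad f ?B x0 $ k\<bar> \<le> K"
        using component_le_norm_cart[of "grad f ?B x0" k] K(2)[OF i(2)] by linarith
      then have "- K * t \<le> grad f ?B x0 $ k * t" using t by (intro mult_right_mono) auto
      then show ?thesis using gh(1)[OF ws] by (simp add: v inner_add_right inner_axis mult.commute)
    qed
    moreover have "K / 2 * (norm v)\<^sup>2 \<le> K / 2 * ((norm w)\<^sup>2 + t)"
    proof -
      have "t\<^sup>2 \<le> t" using t that by (simp add: power2_eq_square mult_left_le t_def)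
      then show ?thesis
        using norm_split_component[of v k] t w K0 by (intro mult_left_mono) (auto simp: v_def)
    qed
    moreover have "0 \<le> K * (norm w)\<^sup>2" using K0 by simp
    moreover have "3 * K / 2 * ((norm w)\<^sup>2 + t) = K / 2 * ((norm w)\<^sup>2 + t) + K * (norm w)\<^sup>2 + K * t"
      by (simp add: field_simps)
    ultimately show ?thesis unfolding aniso by linarith
  qed
qed

section \<open>Integrals of the anisotropic model\<close>

lemma nn_integral_inverse_one_plus_square_finite:
  "(\<integral>\<^sup>+t. ennreal (inverse (1 + t\<^sup>2)) \<partial>lborel) < \<infinity>"
proof -
  have "integrable lborel (\<lambda>t::real. inverse (1 + t\<^sup>2))"
    using integrable_inverse_1_plus_square by (simp add: set_integrable_def einterval_def)
  then show ?thesis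
    by (subst nn_integral_eq_integral) (auto simp: add_nonneg_pos less_imp_le)
qed

lemma nn_integral_linear_exp_finite:
  assumes "0 < c"
  shows "(\<integral>\<^sup>+t. ennreal ((1 + \<bar>t\<bar>) * exp (- c * \<bar>t\<bar>)) \<partial>lborel) < \<infinity>"
proof -
  define b where "b = 4 * (1 + 6 / c ^ 3)"
  have b: "0 \<le> b" using assms by (simp add: b_def)
  have "(1 + \<bar>t\<bar>) * exp (- c * \<bar>t\<bar>) \<le> b * inverse (1 + t\<^sup>2)" for t :: real
  proof -
    define s where "s = \<bar>t\<bar>"
    have s: "0 \<le> s" "t\<^sup>2 = s\<^sup>2" by (auto simp: s_def)
    \<comment> \<open>One term of the exponential series beats the cubic growth of \<open>(1 + s) * (1 + s\<^sup>2)\<close>.\<close>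
    have "(c * s) ^ 3 / fact 3 \<le> exp (c * s)"
    proof -
      have "(\<lambda>n. (c * s) ^ n /\<^sub>R fact n) sums exp (c * s)" by (rule exp_converges)
      from sum_le_suminf[OF sums_summable[OF this], of "{3}"] s assms sums_unique[OF this]
      show ?thesis by (simp add: field_simps)
    qed
    then have "s ^ 3 \<le> 6 / c ^ 3 * exp (c * s)"
      using assms by (simp add: field_simps power_mult_distrib fact_numeral)
    moreover have "1 \<le> exp (c * s)" using s assms by simp
    ultimately have "1 + s ^ 3 \<le> exp (c * s) + 6 / c ^ 3 * exp (c * s)" by linarith
    also have "\<dots> = (1 + 6 / c ^ 3) * exp (c * s)" by (simp add: distrib_right)
    finally have "4 * (1 + s ^ 3) \<le> b * exp (c * s)"
      unfolding b_def mult.assoc by (rule mult_left_mono) simp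
    moreover have "(1 + s) * (1 + s\<^sup>2) \<le> 4 * (1 + s ^ 3)"
    proof -
      have "4 * (1 + s ^ 3) - (1 + s) * (1 + s\<^sup>2) = 3 * (1 + s) * (s - 1)\<^sup>2 + 2 * s * (1 + s)"
        by (simp add: power2_eq_square power3_eq_cube algebra_simps)
      moreover have "0 \<le> 3 * (1 + s) * (s - 1)\<^sup>2 + 2 * s * (1 + s)" using s by simp
      ultimately show ?thesis by linarith
    qed
    ultimately have "(1 + s) * (1 + s\<^sup>2) \<le> b * exp (c * s)" by linarith
    moreover have "0 < 1 + s\<^sup>2" by (simp add: add_pos_nonneg)
    ultimately show ?thesis
      unfolding s(2) s_def[symmetric] by (simp add: exp_minus field_simps)
  qed
  then have "(\<integral>\<^sup>+t. ennreal ((1 + \<bar>t\<bar>) * exp (- c * \<bar>t\<bar>)) \<partial>lborel)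
      \<le> (\<integral>\<^sup>+t. ennreal b * ennreal (inverse (1 + t\<^sup>2)) \<partial>lborel)"
    using b by (intro nn_integral_mono) (auto simp: ennreal_mult'[symmetric] intro!: ennreal_leI)
  also have "\<dots> = ennreal b * (\<integral>\<^sup>+t. ennreal (inverse (1 + t\<^sup>2)) \<partial>lborel)"
    by (rule nn_integral_cmult) simp
  also have "\<dots> < \<infinity>"
    using nn_integral_inverse_one_plus_square_finite by (simp add: ennreal_mult_less_top)
  finally show ?thesis .
qed

lemma one_plus_sum_le_prod:
  fixes a :: "'a \<Rightarrow> real"
  assumes "finite A" and "\<And>i. i \<in> A \<Longrightarrow> 0 \<le> a i"
  shows "1 + sum a A \<le> (\<Prod>i\<in>A. 1 + a i)"
  using assms
proof (induction A)
  case (insert i A)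
  have "0 \<le> a i * sum a A"
    using insert.prems by (intro mult_nonneg_nonneg sum_nonneg) auto
  then have "1 + sum a (insert i A) \<le> (1 + a i) * (1 + sum a A)"
    using insert.hyps by (simp add: algebra_simps)
  also have "\<dots> \<le> (1 + a i) * (\<Prod>i\<in>A. 1 + a i)"
    using insert by (intro mult_left_mono) auto
  finally show ?case using insert.hyps by simp
qed simp

text \<open>
  The inverse width, in the \<open>i\<close>-th coordinate, of the region where \<open>N * aniso I v\<close> stays bounded.
\<close>

definition rate :: "'n set \<Rightarrow> nat \<Rightarrow> 'n \<Rightarrow> real" where
  "rate I N i = (if i \<in> I then sqrt (real N) else real N)"

lemma sqrt_le_rate: "0 < N \<Longrightarrow> sqrt (real N) \<le> rate I N i"
  by (simp add: rate_def real_le_lsqrt power2_eq_square)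

lemma rate_le: "0 < N \<Longrightarrow> rate I N i \<le> real N"
  by (simp add: rate_def real_le_lsqrt power2_eq_square)

lemma rate_pos: "0 < N \<Longrightarrow> 0 < rate I N i"
  by (simp add: rate_def)

lemma mult_aniso:
  "real N * aniso I v = (\<Sum>i\<in>UNIV. if i \<in> I then (rate I N i * v $ i)\<^sup>2 else \<bar>rate I N i * v $ i\<bar>)"
  unfolding aniso_def sum_distrib_left
  by (intro sum.cong) (auto simp: rate_def power_mult_distrib abs_mult)

text \<open>
  The volume of the box with side lengths \<open>1 / rate I N i\<close>. Up to constants it is the mass that
  \<open>exp (- N * aniso I v)\<close> gives to the whole space.
\<close>

definition box_volume :: "'n::finite set \<Rightarrow> nat \<Rightarrow> real" where
  "box_volume I N = (\<Prod>i\<in>UNIV. 1 / rate I N i)"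

lemma box_volume_pos: "0 < N \<Longrightarrow> 0 < box_volume I N"
  by (auto simp: box_volume_def rate_pos intro!: prod_pos)

lemma inverse_box_volume_le: "0 < N \<Longrightarrow> 1 / box_volume (I :: 'n::finite set) N \<le> real N ^ CARD('n)"
proof -
  assume "0 < N"
  have "1 / box_volume I N = (\<Prod>i\<in>UNIV. rate I N i)"
    by (simp add: box_volume_def prod_dividef)
  also have "\<dots> \<le> (\<Prod>i\<in>(UNIV :: 'n set). real N)"
    using \<open>0 < N\<close> by (intro prod_mono) (auto simp: rate_le rate_pos less_imp_le)
  finally show ?thesis by simp
qed

text \<open>
  In the rescaled coordinates \<open>rate I N i * v $ i\<close> the integrand is bounded by a product of
  functions of one variable that do not depend on \<open>N\<close>; \<open>\<bar>t\<bar> - 1 \<le> t\<^sup>2\<close> reduces the Gaussian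
  factors to exponential ones at the price of the factor \<open>exp c\<close>.
\<close>

lemma moment_integrand_le_prod:
  fixes v :: "real^'n"
  assumes "0 < c" and "0 < N"
  shows "(1 + sqrt N * norm v) * exp (- c * (real N * aniso I v))
    \<le> (\<Prod>i\<in>UNIV. exp c * ((1 + \<bar>rate I N i * v $ i\<bar>) * exp (- c * \<bar>rate I N i * v $ i\<bar>)))"
proof -
  let ?x = "\<lambda>i. rate I N i * v $ i"
  have "sqrt N * norm v \<le> sqrt N * (\<Sum>i\<in>UNIV. \<bar>v $ i\<bar>)"
    by (intro mult_left_mono norm_le_l1_cart) auto
  also have "\<dots> \<le> (\<Sum>i\<in>UNIV. \<bar>?x i\<bar>)"
    unfolding sum_distrib_left abs_mult
    using assms sqrt_le_rate[of N I] rate_pos[of N I]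
    by (intro sum_mono mult_right_mono) (auto simp: abs_of_pos)
  finally have 1: "1 + sqrt N * norm v \<le> (\<Prod>i\<in>UNIV. 1 + \<bar>?x i\<bar>)"
    using one_plus_sum_le_prod[of UNIV "\<lambda>i. \<bar>?x i\<bar>"] by simp
  have "(\<Sum>i\<in>UNIV. c * \<bar>?x i\<bar> - c) \<le> c * (real N * aniso I v)"
    unfolding mult_aniso sum_distrib_left
  proof (intro sum_mono)
    fix i
    have "\<bar>?x i\<bar> - 1 \<le> (?x i)\<^sup>2"
    proof (cases "\<bar>?x i\<bar> \<le> 1")
      case False
      then have "\<bar>?x i\<bar> * 1 \<le> \<bar>?x i\<bar> * \<bar>?x i\<bar>" by (intro mult_left_mono) auto
      then show ?thesis by (simp add: power2_eq_square)
    qed (simp add: order_trans[OF _ zero_le_power2])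
    then have "c * (\<bar>?x i\<bar> - 1) \<le> c * (if i \<in> I then (?x i)\<^sup>2 else \<bar>?x i\<bar>)"
      using assms by (intro mult_left_mono) auto
    then show "c * \<bar>?x i\<bar> - c \<le> c * (if i \<in> I then (?x i)\<^sup>2 else \<bar>?x i\<bar>)"
      by (simp add: algebra_simps)
  qed
  then have "exp (- c * (real N * aniso I v)) \<le> exp (\<Sum>i\<in>UNIV. c - c * \<bar>?x i\<bar>)"
    by (simp add: sum_subtractf)
  also have "\<dots> = (\<Prod>i\<in>UNIV. exp c * exp (- c * \<bar>?x i\<bar>))"
    by (simp add: exp_sum exp_diff exp_minus field_simps)
  finally have "(1 + sqrt N * norm v) * exp (- c * (real N * aniso I v))
      \<le> (\<Prod>i\<in>UNIV. 1 + \<bar>?x i\<bar>) * (\<Prod>i\<in>UNIV. exp c * exp (- c * \<bar>?x i\<bar>))"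
    using 1 by (intro mult_mono prod_nonneg) auto
  then show ?thesis by (simp add: prod.distrib[symmetric] mult_ac)
qed

text \<open>
  Since each \<open>rate I N i\<close> is at least \<open>sqrt N\<close>, the distance from the centre is at most of order
  \<open>1 / sqrt N\<close> on average, even where the concentration is faster.
\<close>

lemma aniso_moment_bound:
  fixes I :: "'n::finite set"
  assumes c: "0 < c"
  obtains J where "0 \<le> J" and
    "\<And>N. 0 < N \<Longrightarrow> (\<integral>\<^sup>+v. ennreal ((1 + sqrt N * norm v) * exp (- c * (real N * aniso I v))) \<partial>lborel)
      \<le> ennreal (J * box_volume I N)"
proof -
  define g where "g t = exp c * ((1 + \<bar>t\<bar>) * exp (- c * \<bar>t\<bar>))" for t :: real
  have [measurable]: "g \<in> borel_measurable borel" unfolding g_def by measurable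
  have g0: "0 \<le> g t" for t by (simp add: g_def)
  define G where "G = enn2real (\<integral>\<^sup>+t. g t \<partial>lborel)"
  have "(\<integral>\<^sup>+t. g t \<partial>lborel) = ennreal (exp c) * (\<integral>\<^sup>+t. ennreal ((1 + \<bar>t\<bar>) * exp (- c * \<bar>t\<bar>)) \<partial>lborel)"
    unfolding g_def by (subst nn_integral_cmult[symmetric]) (auto simp: ennreal_mult')
  also have "\<dots> < \<infinity>"
    using nn_integral_linear_exp_finite[OF c] by (simp add: ennreal_mult_less_top)
  finally have G: "(\<integral>\<^sup>+t. g t \<partial>lborel) = ennreal G"
    by (simp add: G_def)
  have G0: "0 \<le> G" by (simp add: G_def)
  have scaled: "(\<integral>\<^sup>+t. g (w * t) \<partial>lborel) = ennreal (G * (1 / w))" if w: "0 < w" for w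
  proof -
    have "ennreal w * (\<integral>\<^sup>+t. g (w * t) \<partial>lborel) = ennreal G"
      using nn_integral_real_affine[of "\<lambda>t. ennreal (g t)" w 0] w by (simp add: G)
    then have "ennreal (1 / w) * (ennreal w * (\<integral>\<^sup>+t. g (w * t) \<partial>lborel)) = ennreal (G * (1 / w))"
      using G0 w by (simp add: ennreal_mult'[symmetric] mult.commute)
    then show ?thesis
      using w by (simp add: mult.assoc[symmetric] ennreal_mult'[symmetric])
  qed
  show ?thesis
  proof
    show "0 \<le> G ^ CARD('n)" using G0 by simp
    fix N :: nat assume N: "0 < N"
    have reindex: "(\<Prod>b\<in>Basis. h b) = (\<Prod>i\<in>UNIV. h (axis i 1))" for h :: "real^'n \<Rightarrow> 'b::comm_monoid_mult"
    proof -
      have B: "Basis = range (\<lambda>i. axis i (1::real) :: real^'n)"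
        by (auto simp: Basis_vec_def)
      have "inj (\<lambda>i. axis i (1::real) :: real^'n)"
        by (auto simp: inj_on_def axis_eq_axis)
      from prod.reindex[OF this, of h] show ?thesis by (simp only: B o_def)
    qed
    have "(\<integral>\<^sup>+v. ennreal ((1 + sqrt N * norm v) * exp (- c * (real N * aniso I v))) \<partial>lborel)
        \<le> (\<integral>\<^sup>+v. (\<Prod>b\<in>(Basis :: (real^'n) set). ennreal (g (rate I N (axis_index b) * (v \<bullet> b)))) \<partial>lborel)"
    proof (rule nn_integral_mono)
      fix v :: "real^'n"
      have "(\<Prod>b\<in>Basis. ennreal (g (rate I N (axis_index b) * (v \<bullet> b))))
          = ennreal (\<Prod>i\<in>UNIV. g (rate I N i * v $ i))"
        by (simp add: reindex axis_index_axis inner_axis prod_ennreal g0)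
      then show "ennreal ((1 + sqrt N * norm v) * exp (- c * (real N * aniso I v)))
          \<le> (\<Prod>b\<in>Basis. ennreal (g (rate I N (axis_index b) * (v \<bullet> b))))"
        using moment_integrand_le_prod[OF c N, of v I] by (simp add: g_def ennreal_leI)
    qed
    also have "\<dots> = (\<Prod>b\<in>(Basis :: (real^'n) set). \<integral>\<^sup>+t. ennreal (g (rate I N (axis_index b) * t)) \<partial>lborel)"
      by (rule nn_integral_lborel_prod) auto
    also have "\<dots> = (\<Prod>i\<in>UNIV. ennreal (G * (1 / rate I N i)))"
      using scaled rate_pos[OF N, of I] by (simp add: reindex axis_index_axis)
    also have "\<dots> = ennreal (\<Prod>i\<in>UNIV. G * (1 / rate I N i))"
      using G0 rate_pos[OF N, of I] by (intro prod_ennreal) (auto simp: less_imp_le)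
    also have "(\<Prod>i\<in>UNIV. G * (1 / rate I N i)) = G ^ CARD('n) * box_volume I N"
      by (simp add: box_volume_def prod_dividef)
    finally show "(\<integral>\<^sup>+v. ennreal ((1 + sqrt N * norm v) * exp (- c * (real N * aniso I v))) \<partial>lborel)
      \<le> ennreal (G ^ CARD('n) * box_volume I N)" .
  qed
qed

text \<open>
  The normalising integral is bounded below by its part over a box with corner \<open>x0\<close> on which
  \<open>N * aniso I (x - x0)\<close> is at most the dimension. Placing \<open>x0\<close> at the lower corner keeps the box
  on the side \<open>x $ k \<ge> 0\<close> of a boundary maximum.
\<close>

lemma partition_function_lower:
  fixes F :: "real^'n \<Rightarrow> real"
  assumes N: "0 < N" and "0 \<le> C" and S: "S \<in> sets lebesgue"
    and int: "set_integrable lebesgue S (\<lambda>x. exp (real N * F x))"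
    and box: "\<And>x. x \<in> cbox x0 (x0 + (\<chi> i. 1 / rate I N i)) \<Longrightarrow>
      x \<in> S \<and> F x0 - C * aniso I (x - x0) \<le> F x"
  shows "exp (real N * F x0) * (exp (- C * CARD('n)) * box_volume I N)
    \<le> (LINT x:S|lebesgue. exp (real N * F x))"
proof -
  define Q where "Q = cbox x0 (x0 + (\<chi> i. 1 / rate I N i))"
  define m where "m = exp (real N * F x0) * exp (- C * CARD('n))"
  have mF: "m \<le> exp (real N * F x)" if x: "x \<in> Q" for x
  proof -
    have "real N * aniso I (x - x0) \<le> (\<Sum>i\<in>(UNIV :: 'n set). 1)"
      unfolding mult_aniso
    proof (intro sum_mono)
      fix i
      have "0 \<le> (x - x0) $ i" "(x - x0) $ i \<le> 1 / rate I N i"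
        using x by (auto simp: Q_def mem_box_cart algebra_simps)
      then have "0 \<le> rate I N i * (x - x0) $ i" "rate I N i * (x - x0) $ i \<le> 1"
        using rate_pos[OF N, of I i] by (auto simp: field_simps)
      then show "(if i \<in> I then (rate I N i * (x - x0) $ i)\<^sup>2 else \<bar>rate I N i * (x - x0) $ i\<bar>) \<le> 1"
        by (auto simp: power_le_one)
    qed
    then have "C * (real N * aniso I (x - x0)) \<le> C * CARD('n)"
      using \<open>0 \<le> C\<close> by (intro mult_left_mono) auto
    moreover have "real N * (F x0 - C * aniso I (x - x0)) \<le> real N * F x"
      using box x by (intro mult_left_mono) (auto simp: Q_def)
    ultimately have "real N * F x0 - C * CARD('n) \<le> real N * F x"
      by (simp add: algebra_simps)
    then show ?thesis by (simp add: m_def exp_add[symmetric])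
  qed
  have Q: "measure lebesgue Q = box_volume I N"
  proof -
    have "x0 \<in> Q"
      using rate_pos[OF N, of I] by (simp add: Q_def mem_box_cart less_imp_le)
    then have "measure lborel Q = (\<Prod>i\<in>UNIV. (x0 + (\<chi> i. 1 / rate I N i)) $ i - x0 $ i)"
      unfolding Q_def by (intro content_cbox_cart) blast
    then show ?thesis by (simp add: box_volume_def Q_def measure_completion)
  qed
  have "m * measure lebesgue Q = (LINT x:Q|lebesgue. m)"
    by (simp add: set_lebesgue_integral_def mult.commute Q_def)
  also have "\<dots> \<le> (LINT x:S|lebesgue. exp (real N * F x))"
    unfolding set_lebesgue_integral_def
  proof (rule integral_mono)
    show "integrable lebesgue (\<lambda>x. indicator Q x *\<^sub>R m)"
      using emeasure_bounded_finite[OF bounded_cbox]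
      by (auto simp: Q_def intro!: integrable_mult_left integrable_real_indicator)
    show "integrable lebesgue (\<lambda>x. indicator S x *\<^sub>R exp (real N * F x))"
      using int by (simp add: set_integrable_def)
    show "indicator Q x *\<^sub>R m \<le> indicator S x *\<^sub>R exp (real N * F x)" for x
      using mF[of x] box[of x] by (auto simp: Q_def indicator_def)
  qed
  finally show ?thesis by (simp add: Q m_def mult_ac)
qed

section \<open>Moments of Gibbs laws\<close>

text \<open>
  Transfer of expectations to Lebesgue integrals. The weight \<open>w\<close> is only Lebesgue measurable, so the
  law of \<open>X\<close> is represented as the image, on Borel sets, of a density over \<open>lebesgue\<close>.
\<close>

lemma nn_integral_gibbs:
  fixes X :: "'w \<Rightarrow> real^'n" and w :: "real^'n \<Rightarrow> real"
  assumes "prob_space M" and X[measurable]: "X \<in> borel_measurable M"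
    and XS: "\<And>\<omega>. \<omega> \<in> space M \<Longrightarrow> X \<omega> \<in> S" and S: "S \<in> sets borel"
    and int: "set_integrable lebesgue S w" and w: "\<And>x. 0 \<le> w x" and Z: "0 < Z"
    and law: "\<And>A. A \<in> sets borel \<Longrightarrow> A \<subseteq> S \<Longrightarrow>
      measure M {\<omega> \<in> space M. X \<omega> \<in> A} = (LINT x:A|lebesgue. w x) / Z"
    and \<phi>[measurable]: "\<phi> \<in> borel_measurable borel"
  shows "(\<integral>\<^sup>+\<omega>. \<phi> (X \<omega>) \<partial>M) = (\<integral>\<^sup>+x. \<phi> x * ennreal (indicator S x * w x / Z) \<partial>lebesgue)"
proof -
  interpret prob_space M by fact
  define d where "d x = indicator S x * w x / Z" for x
  have id: "integrable lebesgue d"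
    using int by (simp add: d_def[abs_def] set_integrable_def)
  have [measurable]: "d \<in> borel_measurable lebesgue"
    using id by (rule borel_measurable_integrable)
  define \<nu> where "\<nu> = density lebesgue (\<lambda>x. ennreal (d x))"
  have idm: "(\<lambda>x. x) \<in> measurable \<nu> borel"
    unfolding \<nu>_def by (simp add: measurable_ident_sets measurable_completion)
  have "distr M borel X = distr \<nu> borel (\<lambda>x. x)"
  proof (rule measure_eqI)
    fix A assume "A \<in> sets (distr M borel X)"
    then have A[measurable]: "A \<in> sets borel" by simp
    have Al: "A \<in> sets lebesgue" using A by (simp add: sets_completionI_sets)
    have AS: "A \<inter> S \<in> sets borel" using A S by auto
    have "emeasure (distr M borel X) A = emeasure M {\<omega> \<in> space M. X \<omega> \<in> A \<inter> S}"
      using XS by (subst emeasure_distr) (auto intro!: arg_cong[where f = "emeasure M"])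
    also have "\<dots> = ennreal ((LINT x:A \<inter> S|lebesgue. w x) / Z)"
      using law[OF AS] by (simp add: emeasure_eq_measure)
    also have "(LINT x:A \<inter> S|lebesgue. w x) / Z = (\<integral>x. d x * indicator A x \<partial>lebesgue)"
    proof -
      have "(\<integral>x. d x * indicator A x \<partial>lebesgue) = (\<integral>x. (indicator (A \<inter> S) x *\<^sub>R w x) / Z \<partial>lebesgue)"
        by (intro Bochner_Integration.integral_cong) (auto simp: d_def indicator_def)
      then show ?thesis by (simp add: set_lebesgue_integral_def)
    qed
    also have "ennreal \<dots> = (\<integral>\<^sup>+x. ennreal (d x * indicator A x) \<partial>lebesgue)"
      using integrable_real_mult_indicator[OF Al id] w Z
      by (intro nn_integral_eq_integral[symmetric]) (auto simp: d_def)
    also have "\<dots> = (\<integral>\<^sup>+x. ennreal (d x) * indicator A x \<partial>lebesgue)"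
      by (intro nn_integral_cong) (auto simp: indicator_def)
    also have "\<dots> = emeasure \<nu> A"
      unfolding \<nu>_def using Al by (simp add: emeasure_density)
    also have "\<dots> = emeasure (distr \<nu> borel (\<lambda>x. x)) A"
      using idm A by (subst emeasure_distr) (auto simp: \<nu>_def)
    finally show "emeasure (distr M borel X) A = emeasure (distr \<nu> borel (\<lambda>x. x)) A" .
  qed simp
  then have "(\<integral>\<^sup>+x. \<phi> x \<partial>distr M borel X) = (\<integral>\<^sup>+x. \<phi> x \<partial>distr \<nu> borel (\<lambda>x. x))"
    by simp
  also have "\<dots> = (\<integral>\<^sup>+x. \<phi> x \<partial>\<nu>)"
    by (rule nn_integral_distr[OF idm]) simp
  also have "\<dots> = (\<integral>\<^sup>+x. ennreal (d x) * \<phi> x \<partial>lebesgue)"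
    unfolding \<nu>_def by (rule nn_integral_density) (auto intro: measurable_completion)
  finally show ?thesis
    by (simp add: nn_integral_distr d_def mult.commute)
qed

lemma nn_integral_lebesgue_shift:
  fixes h :: "real^'n \<Rightarrow> ennreal"
  assumes [measurable]: "h \<in> borel_measurable borel"
  shows "(\<integral>\<^sup>+x. h (x - a) \<partial>lebesgue) = (\<integral>\<^sup>+x. h x \<partial>lborel)"
proof -
  have "(\<integral>\<^sup>+x. h x \<partial>lborel) = (\<integral>\<^sup>+x. h x \<partial>distr lborel borel ((+) (- a)))"
    by (simp add: lborel_distr_plus)
  also have "\<dots> = (\<integral>\<^sup>+x. h (x - a) \<partial>lborel)"
    by (subst nn_integral_distr) simp_all
  finally show ?thesis by (simp add: nn_integral_completion)
qed

lemma aniso_measurable [measurable]: "aniso (I :: 'n::finite set) \<in> borel_measurable borel"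
proof -
  have "(\<lambda>v::real^'n. if i \<in> I then (v $ i)\<^sup>2 else \<bar>v $ i\<bar>) \<in> borel_measurable borel" for i
    by (cases "i \<in> I") (auto intro!: borel_measurable_continuous_onI continuous_intros)
  then show ?thesis unfolding aniso_def[abs_def] by (intro borel_measurable_sum)
qed

text \<open>
  The estimate for one fixed \<open>N\<close>. Near the maximiser the weight is compared with the model
  \<open>exp (- c * N * aniso I (x - x0))\<close>, and \<open>norm x \<le> norm (x - x0) + norm x0\<close>. Away from it, \<open>N - N0\<close>
  of the \<open>N\<close> factors \<open>exp (F x)\<close> are used for exponential smallness and the remaining \<open>N0\<close> for
  integrability.
\<close>

lemma gibbs_moment_bound:
  fixes F :: "real^'n \<Rightarrow> real"
  assumes N: "0 < N" "N0 \<le> N" and "0 \<le> A" "0 < m"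
    and Z: "exp (real N * F0) * (m * box_volume I N) \<le> Z"
    and near: "\<And>x. x \<in> S \<inter> B \<Longrightarrow> F x \<le> F0 - c * aniso I (x - x0)"
      "\<And>x. x \<in> S \<inter> B \<Longrightarrow> \<phi> x \<le> A * norm x"
    and far: "\<And>x. x \<in> S - B \<Longrightarrow> F x \<le> F0 - \<Delta>"
      "\<And>x. x \<in> S - B \<Longrightarrow> \<phi> x \<le> A * (exp (\<xi> \<bullet> x) + 1)"
    and "\<bar>F0\<bar> \<le> K"
    and tail: "set_integrable lebesgue S (\<lambda>x. (exp (\<xi> \<bullet> x) + 1) * exp (real N0 * F x))"
      "(LINT x:S|lebesgue. (exp (\<xi> \<bullet> x) + 1) * exp (real N0 * F x)) \<le> T"
    and J: "0 \<le> J" "(\<integral>\<^sup>+v. ennreal ((1 + sqrt N * norm v) * exp (- c * (real N * aniso I v))) \<partial>lborel)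
      \<le> ennreal (J * box_volume I N)"
  shows "(\<integral>\<^sup>+x. ennreal (\<phi> x) * ennreal (indicator S x * exp (real N * F x) / Z) \<partial>lebesgue)
    \<le> ennreal (A / m * ((1 / sqrt N + norm x0) * J
        + T * exp (real N0 * K) * exp (- (real N - real N0) * \<Delta>) / box_volume I N))"
proof -
  define P where "P = box_volume I N"
  have P: "0 < P" using N by (simp add: P_def box_volume_pos)
  have Zpos: "0 < Z" using Z P \<open>0 < m\<close> by (smt (verit) P_def exp_gt_zero mult_pos_pos)
  define a where "a = A / (m * P) * (1 / sqrt N + norm x0)"
  define b where "b = A / (m * P) * (exp (real N0 * K) * exp (- (real N - real N0) * \<Delta>))"
  define g where "g v = (1 + sqrt N * norm v) * exp (- c * (real N * aniso I v))" for v :: "real^'n"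
  define t where "t x = indicator S x * ((exp (\<xi> \<bullet> x) + 1) * exp (real N0 * F x))" for x
  have a: "0 \<le> a" and b: "0 \<le> b" using \<open>0 \<le> A\<close> \<open>0 < m\<close> P by (auto simp: a_def b_def)
  have g: "0 \<le> g v" for v by (simp add: g_def)
  have t: "0 \<le> t x" for x by (simp add: t_def indicator_def add_nonneg_nonneg)
  have it: "integrable lebesgue t"
    using tail(1) by (simp add: set_integrable_def t_def[abs_def])
  have [measurable]: "t \<in> borel_measurable lebesgue"
    using it by (rule borel_measurable_integrable)
  have [measurable]: "g \<in> borel_measurable borel" unfolding g_def[abs_def] by measurable
  have gm: "(\<lambda>x. ennreal (g (x - x0))) \<in> borel_measurable lebesgue"
    by (intro measurable_completion) measurable
  have div: "y / Z \<le> y * exp (- (real N * F0)) / (m * P)" if "0 \<le> y" for y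
  proof -
    have "y / Z \<le> y / (exp (real N * F0) * (m * P))"
      using Z that P \<open>0 < m\<close> Zpos by (intro divide_left_mono) (auto simp: P_def intro!: mult_pos_pos)
    then show ?thesis by (simp add: exp_minus field_simps)
  qed
  have pointwise: "\<phi> x * (indicator S x * exp (real N * F x) / Z) \<le> a * g (x - x0) + b * t x" for x
  proof (cases "x \<in> S")
    case False
    then show ?thesis using a b g[of "x - x0"] t[of x] by simp
  next
    case xS: True
    have w: "exp (real N * F x) / Z \<le> exp (real N * (F x - F0)) / (m * P)"
      using div[of "exp (real N * F x)"] by (simp add: exp_add[symmetric] algebra_simps)
    show ?thesis
    proof (cases "x \<in> B")
      case True
      let ?v = "x - x0"
      have "real N * (F x - F0) \<le> real N * (- c * aniso I ?v)"
        using near(1)[of x] xS True by (intro mult_left_mono) auto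
      then have "exp (real N * (F x - F0)) \<le> exp (- c * (real N * aniso I ?v))"
        by (simp add: mult_ac)
      then have e: "exp (real N * F x) / Z \<le> exp (- c * (real N * aniso I ?v)) / (m * P)"
        using w P \<open>0 < m\<close> by (smt (verit) divide_right_mono mult_pos_pos)
      have "norm x \<le> norm ?v + norm x0"
        by (metis diff_add_cancel norm_triangle_ineq)
      also have "\<dots> \<le> (1 / sqrt N + norm x0) * (1 + sqrt N * norm ?v)"
        using N by (simp add: field_simps add_nonneg_nonneg)
      finally have "A * norm x \<le> A * ((1 / sqrt N + norm x0) * (1 + sqrt N * norm ?v))"
        using \<open>0 \<le> A\<close> by (intro mult_left_mono)
      then have "\<phi> x \<le> A * ((1 / sqrt N + norm x0) * (1 + sqrt N * norm ?v))"
        using near(2)[of x] xS True by auto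
      then have "\<phi> x * (exp (real N * F x) / Z) \<le> A * ((1 / sqrt N + norm x0) * (1 + sqrt N * norm ?v))
          * (exp (- c * (real N * aniso I ?v)) / (m * P))"
        using e \<open>0 \<le> A\<close> Zpos by (intro mult_mono) auto
      also have "\<dots> = a * g ?v" by (simp add: a_def g_def)
      finally show ?thesis using xS b t[of x] by (simp add: add_increasing2)
    next
      case False
      have "(real N - real N0) * (F x - F0) \<le> (real N - real N0) * (- \<Delta>)"
        using far(1)[of x] xS False N by (intro mult_left_mono) auto
      moreover have "- (real N0 * F0) \<le> real N0 * K"
      proof -
        have "real N0 * (- F0) \<le> real N0 * K" using \<open>\<bar>F0\<bar> \<le> K\<close> by (intro mult_left_mono) auto
        then show ?thesis by simp
      qed
      ultimately have "real N * (F x - F0) \<le> real N0 * K + - (real N - real N0) * \<Delta> + real N0 * F x"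
        by (simp add: algebra_simps)
      then have "exp (real N * (F x - F0))
          \<le> exp (real N0 * K) * exp (- (real N - real N0) * \<Delta>) * exp (real N0 * F x)"
        by (simp only: exp_add[symmetric] exp_le_cancel_iff)
      then have "exp (real N * F x) / Z
          \<le> exp (real N0 * K) * exp (- (real N - real N0) * \<Delta>) * exp (real N0 * F x) / (m * P)"
        using w P \<open>0 < m\<close> by (smt (verit) divide_right_mono mult_pos_pos)
      then have "\<phi> x * (exp (real N * F x) / Z) \<le> A * (exp (\<xi> \<bullet> x) + 1)
          * (exp (real N0 * K) * exp (- (real N - real N0) * \<Delta>) * exp (real N0 * F x) / (m * P))"
        using far(2)[of x] xS False \<open>0 \<le> A\<close> Zpos by (intro mult_mono) (auto simp: add_nonneg_nonneg)
      also have "\<dots> = b * t x" using xS by (simp add: b_def t_def)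
      finally show ?thesis using xS a g[of "x - x0"] by (simp add: add_increasing)
    qed
  qed
  have "(\<integral>\<^sup>+x. ennreal (\<phi> x) * ennreal (indicator S x * exp (real N * F x) / Z) \<partial>lebesgue)
      \<le> (\<integral>\<^sup>+x. ennreal a * ennreal (g (x - x0)) + ennreal b * ennreal (t x) \<partial>lebesgue)"
  proof (rule nn_integral_mono)
    fix x
    have "ennreal (\<phi> x) * ennreal (indicator S x * exp (real N * F x) / Z)
        = ennreal (\<phi> x * (indicator S x * exp (real N * F x) / Z))"
      using Zpos by (intro ennreal_mult''[symmetric]) simp
    also have "\<dots> \<le> ennreal (a * g (x - x0) + b * t x)"
      by (rule ennreal_leI) (rule pointwise)
    also have "\<dots> = ennreal a * ennreal (g (x - x0)) + ennreal b * ennreal (t x)"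
      using a b g[of "x - x0"] t[of x] by (simp add: ennreal_mult ennreal_plus)
    finally show "ennreal (\<phi> x) * ennreal (indicator S x * exp (real N * F x) / Z)
        \<le> ennreal a * ennreal (g (x - x0)) + ennreal b * ennreal (t x)" .
  qed
  also have "\<dots> = ennreal a * (\<integral>\<^sup>+x. ennreal (g (x - x0)) \<partial>lebesgue) + ennreal b * (\<integral>\<^sup>+x. ennreal (t x) \<partial>lebesgue)"
    using gm by (subst nn_integral_add) (auto simp: nn_integral_cmult)
  also have "(\<integral>\<^sup>+x. ennreal (g (x - x0)) \<partial>lebesgue) = (\<integral>\<^sup>+v. ennreal (g v) \<partial>lborel)"
    by (rule nn_integral_lebesgue_shift) simp
  also have "(\<integral>\<^sup>+x. ennreal (t x) \<partial>lebesgue) = ennreal (\<integral>x. t x \<partial>lebesgue)"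
    using it t by (intro nn_integral_eq_integral) auto
  also have "ennreal a * (\<integral>\<^sup>+v. ennreal (g v) \<partial>lborel) + ennreal b * ennreal (\<integral>x. t x \<partial>lebesgue)
      \<le> ennreal a * ennreal (J * P) + ennreal b * ennreal T"
    using J(2) tail(2)
    by (intro add_mono mult_left_mono ennreal_leI)
      (auto simp: g_def P_def t_def set_lebesgue_integral_def)
  also have "\<dots> = ennreal (a * (J * P) + b * T)"
  proof -
    have "0 \<le> (\<integral>x. t x \<partial>lebesgue)" by (rule Bochner_Integration.integral_nonneg) (rule t)
    also have "\<dots> \<le> T" using tail(2) by (simp add: t_def set_lebesgue_integral_def)
    finally show ?thesis using a b J(1) P by (simp add: ennreal_mult ennreal_plus)
  qed
  also have "a * (J * P) + b * T = A / m * ((1 / sqrt N + norm x0) * J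
        + T * exp (real N0 * K) * exp (- (real N - real N0) * \<Delta>) / P)"
  proof -
    have "A / (m * P) * s * (J * P) + A / (m * P) * e * T = A / m * (s * J + T * e / P)" for s e
      using P \<open>0 < m\<close> by (simp add: field_simps)
    from this[of "1 / sqrt N + norm x0" "exp (real N0 * K) * exp (- (real N - real N0) * \<Delta>)"]
    show ?thesis by (simp only: a_def b_def mult.assoc)
  qed
  finally show ?thesis unfolding P_def .
qed

lemma power_exp_decay:
  assumes "0 < (\<Delta>::real)"
  obtains D where "0 \<le> D" "\<And>N::nat. 0 < N \<Longrightarrow> real N ^ n * exp (- real N * \<Delta>) \<le> D / sqrt N"
proof -
  have "filterlim (\<lambda>N. \<Delta> * real N) at_top sequentially"
    using assms by (intro filterlim_tendsto_pos_mult_at_top[OF tendsto_const]) (auto simp: filterlim_real_sequentially)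
  from filterlim_compose[OF tendsto_power_div_exp_0[of "Suc n"] this]
  have "(\<lambda>N. (\<Delta> * real N) ^ Suc n / exp (\<Delta> * real N)) \<longlonglongrightarrow> 0" .
  then have "Bseq (\<lambda>N. (\<Delta> * real N) ^ Suc n / exp (\<Delta> * real N))"
    using convergent_imp_Bseq convergent_def by blast
  then obtain D where D: "0 < D" "\<And>N. (\<Delta> * real N) ^ Suc n / exp (\<Delta> * real N) \<le> D"
    unfolding Bseq_def by (metis abs_le_D1 real_norm_def)
  show ?thesis
  proof
    show "0 \<le> D / \<Delta> ^ Suc n" using D assms by simp
    fix N :: nat assume N: "0 < N"
    have "real N ^ n * exp (- real N * \<Delta>) = (\<Delta> * real N) ^ Suc n / exp (\<Delta> * real N) / \<Delta> ^ Suc n / real N"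
      using assms N by (simp add: power_mult_distrib exp_minus field_simps)
    also have "\<dots> \<le> D / \<Delta> ^ Suc n / real N"
      using D(2)[of N] assms N by (intro divide_right_mono) auto
    also have "\<dots> \<le> D / \<Delta> ^ Suc n / sqrt N"
      using D(1) assms N by (intro divide_left_mono) (auto simp: real_le_lsqrt power2_eq_square)
    finally show "real N ^ n * exp (- real N * \<Delta>) \<le> D / \<Delta> ^ Suc n / sqrt N" .
  qed
qed

section \<open>Growth in the two cases\<close>

lemma INF_ereal_pos_obtain:
  fixes g :: "'a \<Rightarrow> ereal"
  assumes "0 < (INF p\<in>A. g p)"
  obtains c where "0 < c" "\<And>p. p \<in> A \<Longrightarrow> ereal c \<le> g p"
proof -
  obtain c where c: "0 < ereal c" "ereal c < (INF p\<in>A. g p)"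
    using ereal_dense2[OF assms] by blast
  show ?thesis
  proof
    show "0 < c" using c by simp
    show "ereal c \<le> g p" if "p \<in> A" for p
      using c(2) INF_lower[OF that, of g] by (meson less_imp_le order_trans)
  qed
qed

lemma INF_min_abs_eigenvalue_pos_obtain:
  assumes "0 < (INF p\<in>A. min_abs_eigenvalue I (H p))"
  obtains \<kappa> where "0 < \<kappa>" "\<And>p l. p \<in> A \<Longrightarrow> l \<in> sub_eigenvalues I (H p) \<Longrightarrow> \<kappa> \<le> \<bar>l\<bar>"
proof -
  obtain \<kappa> where \<kappa>: "0 < \<kappa>" "\<And>p. p \<in> A \<Longrightarrow> ereal \<kappa> \<le> min_abs_eigenvalue I (H p)"
    using INF_ereal_pos_obtain[OF assms] by blast
  show ?thesis
  proof
    show "\<kappa> \<le> \<bar>l\<bar>" if "p \<in> A" "l \<in> sub_eigenvalues I (H p)" for p l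
      using order_trans[OF \<kappa>(2)[OF that(1)] INF_lower[OF that(2), of "\<lambda>l. ereal \<bar>l\<bar>", folded min_abs_eigenvalue_def]]
      by simp
  qed fact
qed

lemma eventually_box_subset_ball:
  fixes xs :: "nat \<Rightarrow> real^'n"
  assumes "xs \<longlonglongrightarrow> 0" and "0 < r"
  shows "\<forall>\<^sub>F N in sequentially. cbox (xs N) (xs N + (\<chi> i. 1 / rate I N i)) \<subseteq> ball 0 r"
proof -
  have "(\<lambda>N. norm (xs N)) \<longlonglongrightarrow> 0" using assms by (simp add: tendsto_norm_zero)
  moreover have "(\<lambda>N. real CARD('n) * (1 / sqrt (real N))) \<longlonglongrightarrow> real CARD('n) * 0"
    by (intro tendsto_intros) (use tendsto_real_sqrt[OF lim_1_over_n] in \<open>simp add: real_sqrt_divide\<close>)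
  ultimately have "(\<lambda>N. norm (xs N) + real CARD('n) * (1 / sqrt (real N))) \<longlonglongrightarrow> 0 + real CARD('n) * 0"
    by (rule tendsto_add)
  then have "\<forall>\<^sub>F N in sequentially. norm (xs N) + real CARD('n) * (1 / sqrt (real N)) < r"
    using order_tendstoD(2)[of _ "0 :: real" _ r] \<open>0 < r\<close> by simp
  then show ?thesis
    using eventually_gt_at_top[of 0]
  proof eventually_elim
    case (elim N)
    show ?case
    proof
      fix x assume x: "x \<in> cbox (xs N) (xs N + (\<chi> i. 1 / rate I N i))"
      have "norm (x - xs N) \<le> (\<Sum>i\<in>UNIV. \<bar>(x - xs N) $ i\<bar>)" by (rule norm_le_l1_cart)
      also have "\<dots> \<le> (\<Sum>i\<in>(UNIV :: 'n set). 1 / sqrt N)"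
      proof (rule sum_mono)
        fix i
        have "\<bar>(x - xs N) $ i\<bar> \<le> 1 / rate I N i"
          using x by (auto simp: mem_box_cart algebra_simps)
        also have "\<dots> \<le> 1 / sqrt N"
          using elim by (intro divide_left_mono sqrt_le_rate) (auto simp: rate_pos)
        finally show "\<bar>(x - xs N) $ i\<bar> \<le> 1 / sqrt N" .
      qed
      finally have "norm (x - xs N) \<le> real CARD('n) * (1 / sqrt N)" by simp
      moreover have "norm x \<le> norm (xs N) + norm (x - xs N)"
        by (metis add.commute diff_add_cancel norm_triangle_ineq)
      ultimately show "x \<in> ball 0 r" using elim(1) by simp
    qed
  qed
qed

text \<open>
  Both cases in one form: the set \<open>I\<close> of directions with quadratic decay is everything at an
  interior maximum and \<open>- {k}\<close> at a boundary one. The lower bound is needed only on the box that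
  bounds the normalising integral.
\<close>

lemma anisotropic_growth:
  fixes f :: "real^'n \<Rightarrow> nat \<Rightarrow> real"
  assumes "0 < r" and B: "cball 0 r \<subseteq> \<Omega>"
    and f: "\<And>N. 0 < N \<Longrightarrow> thrice_differentiable_on (\<lambda>z. f z N) (cball 0 r)"
    and K: "\<And>N x. 0 < N \<Longrightarrow> x \<in> cball 0 r \<Longrightarrow> norm (grad (\<lambda>z. f z N) (cball 0 r) x) \<le> K"
      "\<And>N x. 0 < N \<Longrightarrow> x \<in> cball 0 r \<Longrightarrow> mat_norm (hess (\<lambda>z. f z N) (cball 0 r) x) \<le> K"
    and "0 < N0"
    and max: "\<And>N x. N0 \<le> N \<Longrightarrow> x \<in> S \<Longrightarrow> f x N \<le> f (xs N) N"
    and xs: "xs \<longlonglongrightarrow> 0"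
    and cases: "S = \<Omega> \<and> interior_max_case f (cball 0 r) N0 xs \<or>
      S = \<Omega> \<inter> {x. 0 \<le> x $ k} \<and> boundary_max_case f (cball 0 r) r k N0 xs"
  obtains I c C where "0 < c" "0 \<le> C"
    "\<forall>\<^sub>F N in sequentially. \<forall>x \<in> S \<inter> cball 0 r. f x N \<le> f (xs N) N - c * aniso I (x - xs N)"
    "\<forall>\<^sub>F N in sequentially. \<forall>x \<in> cbox (xs N) (xs N + (\<chi> i. 1 / rate I N i)).
      x \<in> S \<and> f (xs N) N - C * aniso I (x - xs N) \<le> f x N"
proof -
  let ?B = "cball 0 r :: (real^'n) set"
  have "norm (grad (\<lambda>z. f z N0) ?B 0) \<le> K"
    using K(1)[OF \<open>0 < N0\<close>] \<open>0 < r\<close> by simp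
  then have K0: "0 \<le> K" using norm_ge_zero order_trans by blast
  have "\<forall>\<^sub>F N in sequentially. dist (xs N) 0 < r"
    using tendstoD[OF xs \<open>0 < r\<close>] .
  then have large: "\<forall>\<^sub>F N in sequentially. N0 \<le> N \<and> xs N \<in> ball 0 r"
    using eventually_ge_at_top[of N0] by eventually_elim (simp add: dist_commute)
  from cases show ?thesis
  proof (elim disjE conjE)
    assume S: "S = \<Omega>" and case_a: "interior_max_case f ?B N0 xs"
    have "0 < (INF p\<in>{N0..} \<times> ?B. min_abs_eigenvalue UNIV (hess (\<lambda>z. f z (fst p)) ?B (snd p)))"
      using case_a unfolding interior_max_case_def case_prod_beta by blast
    then obtain \<kappa> where \<kappa>: "0 < \<kappa>"
      "\<And>p l. p \<in> {N0..} \<times> ?B \<Longrightarrow> l \<in> sub_eigenvalues UNIV (hess (\<lambda>z. f z (fst p)) ?B (snd p)) \<Longrightarrow> \<kappa> \<le> \<bar>l\<bar>"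
      by (rule INF_min_abs_eigenvalue_pos_obtain) blast
    have gap: "\<kappa> \<le> \<bar>l\<bar>" if "N0 \<le> N" "x \<in> ?B" "l \<in> sub_eigenvalues UNIV (hess (\<lambda>z. f z N) ?B x)" for N x l
      using \<kappa>(2)[of "(N, x)" l] that by simp
    have growth: "f x N \<le> f (xs N) N - \<kappa> / 2 * aniso UNIV (x - xs N)"
        "f (xs N) N - K / 2 * aniso UNIV (x - xs N) \<le> f x N"
      if N: "N0 \<le> N \<and> xs N \<in> ball 0 r" and x: "x \<in> ?B" for N x
    proof -
      have "0 < N" using N \<open>0 < N0\<close> by simp
      have m: "f z N \<le> f (xs N) N" if "z \<in> ?B" for z
        using max[of N z] N that S B by auto
      note g = growth_interior_max[of "\<lambda>z. f z N", OF f[OF \<open>0 < N\<close>] \<open>0 < r\<close> \<open>0 < \<kappa>\<close>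
          gap[of N] K(2)[OF \<open>0 < N\<close>] _ m x]
      show "f x N \<le> f (xs N) N - \<kappa> / 2 * aniso UNIV (x - xs N)"
        by (rule g(1)) (use N in auto)
      show "f (xs N) N - K / 2 * aniso UNIV (x - xs N) \<le> f x N"
        by (rule g(2)) (use N in auto)
    qed
    show ?thesis
    proof
      show "0 < \<kappa> / 2" "0 \<le> K / 2" using \<kappa> K0 by auto
      show "\<forall>\<^sub>F N in sequentially. \<forall>x \<in> S \<inter> ?B. f x N \<le> f (xs N) N - \<kappa> / 2 * aniso UNIV (x - xs N)"
        using large by eventually_elim (use growth(1) in blast)
      show "\<forall>\<^sub>F N in sequentially. \<forall>x \<in> cbox (xs N) (xs N + (\<chi> i. 1 / rate UNIV N i)).
          x \<in> S \<and> f (xs N) N - K / 2 * aniso UNIV (x - xs N) \<le> f x N"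
        using large eventually_box_subset_ball[OF xs \<open>0 < r\<close>, of UNIV]
      proof eventually_elim
        case (elim N)
        then have "x \<in> ?B" if "x \<in> cbox (xs N) (xs N + (\<chi> i. 1 / rate UNIV N i))" for x
          using that ball_subset_cball by blast
        then show ?case using growth(2)[OF elim(1)] S B by blast
      qed
    qed
  next
    assume S: "S = \<Omega> \<inter> {x. 0 \<le> x $ k}" and case_b: "boundary_max_case f ?B r k N0 xs"
    have "0 < (INF p\<in>{N0..} \<times> ?B. min_abs_eigenvalue (- {k}) (hess (\<lambda>z. f z (fst p)) ?B (snd p)))"
      using case_b unfolding boundary_max_case_def case_prod_beta by blast
    then obtain \<kappa>1 where \<kappa>1: "0 < \<kappa>1"
      "\<And>p l. p \<in> {N0..} \<times> ?B \<Longrightarrow> l \<in> sub_eigenvalues (- {k}) (hess (\<lambda>z. f z (fst p)) ?B (snd p)) \<Longrightarrow> \<kappa>1 \<le> \<bar>l\<bar>"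
      by (rule INF_min_abs_eigenvalue_pos_obtain) blast
    have "0 < (INF p\<in>{N0..} \<times> ?B. ereal \<bar>grad (\<lambda>z. f z (fst p)) ?B (snd p) $ k\<bar>)"
      using case_b unfolding boundary_max_case_def case_prod_beta by blast
    then obtain \<kappa>2 where \<kappa>2: "0 < \<kappa>2"
      "\<And>p. p \<in> {N0..} \<times> ?B \<Longrightarrow> ereal \<kappa>2 \<le> ereal \<bar>grad (\<lambda>z. f z (fst p)) ?B (snd p) $ k\<bar>"
      by (rule INF_ereal_pos_obtain) blast
    have xk: "xs N $ k = 0" if "N0 \<le> N" for N
      using case_b that by (simp add: boundary_max_case_def)
    define \<kappa> where "\<kappa> = min \<kappa>1 \<kappa>2"
    have \<kappa>: "0 < \<kappa>" "\<kappa> \<le> \<kappa>1" "\<kappa> \<le> \<kappa>2" using \<kappa>1(1) \<kappa>2(1) by (auto simp: \<kappa>_def)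
    have gap: "\<kappa> \<le> \<bar>l\<bar>" if "N0 \<le> N" "x \<in> ?B" "l \<in> sub_eigenvalues (- {k}) (hess (\<lambda>z. f z N) ?B x)" for N x l
      using \<kappa>1(2)[of "(N, x)" l] that \<kappa>(2) by simp
    have slope: "\<kappa> \<le> \<bar>grad (\<lambda>z. f z N) ?B x $ k\<bar>" if "N0 \<le> N" "x \<in> ?B" for N x
      using \<kappa>2(2)[of "(N, x)"] that \<kappa>(3) by simp
    have growth: "f x N \<le> f (xs N) N - \<kappa> / 2 * aniso (- {k}) (x - xs N)"
        "x $ k \<le> 1 \<Longrightarrow> f (xs N) N - 3 * K / 2 * aniso (- {k}) (x - xs N) \<le> f x N"
      if N: "N0 \<le> N \<and> xs N \<in> ball 0 r" and x: "x \<in> ?B" "0 \<le> x $ k" for N x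
    proof -
      have "0 < N" using N \<open>0 < N0\<close> by simp
      have m: "f z N \<le> f (xs N) N" if "z \<in> ?B" "0 \<le> z $ k" for z
        using max[of N z] N that S B by auto
      note g = growth_boundary_max[of "\<lambda>z. f z N", OF f[OF \<open>0 < N\<close>] \<open>0 < r\<close> \<open>0 < \<kappa>\<close>
          gap[of N] slope[of N] K(2)[OF \<open>0 < N\<close>] K(1)[OF \<open>0 < N\<close>] _ xk[of N] m x]
      show "f x N \<le> f (xs N) N - \<kappa> / 2 * aniso (- {k}) (x - xs N)"
        by (rule g(1)) (use N in auto)
      show "f (xs N) N - 3 * K / 2 * aniso (- {k}) (x - xs N) \<le> f x N" if "x $ k \<le> 1"
        by (rule g(2)) (use N that in auto)
    qed
    show ?thesis
    proof
      show "0 < \<kappa> / 2" "0 \<le> 3 * K / 2" using \<kappa> K0 by auto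
      show "\<forall>\<^sub>F N in sequentially. \<forall>x \<in> S \<inter> ?B. f x N \<le> f (xs N) N - \<kappa> / 2 * aniso (- {k}) (x - xs N)"
        using large by eventually_elim (use growth(1) S in blast)
      show "\<forall>\<^sub>F N in sequentially. \<forall>x \<in> cbox (xs N) (xs N + (\<chi> i. 1 / rate (- {k}) N i)).
          x \<in> S \<and> f (xs N) N - 3 * K / 2 * aniso (- {k}) (x - xs N) \<le> f x N"
        using large eventually_box_subset_ball[OF xs \<open>0 < r\<close>, of "- {k}"]
      proof eventually_elim
        case (elim N)
        have "x \<in> ?B \<and> 0 \<le> x $ k \<and> x $ k \<le> 1"
          if x: "x \<in> cbox (xs N) (xs N + (\<chi> i. 1 / rate (- {k}) N i))" for x
        proof -
          have "1 / real N \<le> 1" using elim(1) \<open>0 < N0\<close> by simp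
          moreover have "xs N $ k \<le> x $ k" "x $ k \<le> xs N $ k + 1 / rate (- {k}) N k"
            using x by (auto simp: mem_box_cart)
          ultimately have "0 \<le> x $ k \<and> x $ k \<le> 1"
            using xk[of N] elim(1) by (simp add: rate_def)
          then show ?thesis using x elim(2) ball_subset_cball by blast
        qed
        then show ?case using growth(2)[OF elim(1)] S B by blast
      qed
    qed
  qed
qed

section \<open>Displacement of the maximiser\<close>

lemma norm_sq_le_aniso:
  fixes v :: "real^'n"
  assumes "norm v \<le> 1"
  shows "(norm v)\<^sup>2 \<le> aniso I v"
  unfolding aniso_UNIV[symmetric] unfolding aniso_def
proof (rule sum_mono)
  fix i
  have "\<bar>v $ i\<bar> \<le> 1" using component_le_norm_cart[of v i] assms by simp
  then have "\<bar>v $ i\<bar> * \<bar>v $ i\<bar> \<le> \<bar>v $ i\<bar> * 1" by (intro mult_left_mono) auto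
  then show "(if i \<in> UNIV then (v $ i)\<^sup>2 else \<bar>v $ i\<bar>) \<le> (if i \<in> I then (v $ i)\<^sup>2 else \<bar>v $ i\<bar>)"
    by (simp add: power2_eq_square)
qed

lemma differentiable_imp_locally_lipschitz_at:
  fixes \<sigma> :: "'a::real_normed_vector \<Rightarrow> 'b::real_normed_vector"
  assumes "\<sigma> differentiable (at a)"
  obtains L where "0 \<le> L" "\<forall>\<^sub>F x in nhds a. norm (\<sigma> x - \<sigma> a) \<le> L * norm (x - a)"
proof -
  obtain D where D: "(\<sigma> has_derivative D) (at a)" using assms by (auto simp: differentiable_def)
  then have bl: "bounded_linear D" by (rule has_derivative_bounded_linear)
  from D obtain d where d: "0 < d" "\<And>y. norm (y - a) < d \<Longrightarrow> norm (\<sigma> y - \<sigma> a - D (y - a)) \<le> 1 * norm (y - a)"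
    unfolding has_derivative_at_alt by (meson zero_less_one)
  show ?thesis
  proof
    show "0 \<le> onorm D + 1" using onorm_pos_le[OF bl] by simp
    have "norm (\<sigma> x - \<sigma> a) \<le> (onorm D + 1) * norm (x - a)" if "dist x a < d" for x
      using norm_triangle_ineq[of "\<sigma> x - \<sigma> a - D (x - a)" "D (x - a)"] d(2)[of x] onorm[OF bl, of "x - a"] that
      by (simp add: dist_norm algebra_simps)
    then show "\<forall>\<^sub>F x in nhds a. norm (\<sigma> x - \<sigma> a) \<le> (onorm D + 1) * norm (x - a)"
      using d(1) unfolding eventually_nhds_metric by blast
  qed
qed

text \<open>
  Perturbing the objective by \<open>eps N * \<sigma>\<close> moves the maximiser by \<open>O(eps N)\<close>: the gain in height is at
  most \<open>eps N\<close> times a Lipschitz constant of \<open>\<sigma>\<close> times the displacement, and it has to pay for a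
  quadratic loss.
\<close>

lemma maximiser_drift:
  fixes f0 \<sigma> :: "'a::real_normed_vector \<Rightarrow> real"
  assumes f0: "f0 differentiable (at a)" and \<sigma>: "\<sigma> differentiable (at a)"
    and xs: "xs \<longlonglongrightarrow> a" and eps: "eps \<longlonglongrightarrow> 0" "\<And>N. N0 \<le> N \<Longrightarrow> 0 \<le> eps N"
    and max: "\<And>N N'. N0 \<le> N \<Longrightarrow> N0 \<le> N' \<Longrightarrow>
      f0 (xs N) + eps N' * \<sigma> (xs N) \<le> f0 (xs N') + eps N' * \<sigma> (xs N')"
    and "0 < c"
    and growth: "\<forall>\<^sub>F N in sequentially.
      f0 a + eps N * \<sigma> a \<le> f0 (xs N) + eps N * \<sigma> (xs N) - c * (norm (xs N - a))\<^sup>2"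
  obtains L where "0 \<le> L" "\<forall>\<^sub>F N in sequentially. norm (xs N - a) \<le> L * eps N"
proof -
  have f0xs: "(\<lambda>N. f0 (xs N)) \<longlonglongrightarrow> f0 a" and \<sigma>xs: "(\<lambda>N. \<sigma> (xs N)) \<longlonglongrightarrow> \<sigma> a"
    using isCont_tendsto_compose[OF differentiable_imp_continuous_within xs] f0 \<sigma> by auto
  \<comment> \<open>Let the parameter \<open>N'\<close> of the objective tend to infinity while the competitor \<open>xs N\<close> stays fixed.\<close>
  have limit_max: "f0 (xs N) \<le> f0 a" if "N0 \<le> N" for N
  proof -
    have "(\<lambda>N'. f0 (xs N) + eps N' * \<sigma> (xs N)) \<longlonglongrightarrow> f0 (xs N) + 0 * \<sigma> (xs N)"
      by (intro tendsto_intros eps)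
    moreover have "(\<lambda>N'. f0 (xs N') + eps N' * \<sigma> (xs N')) \<longlonglongrightarrow> f0 a + 0 * \<sigma> a"
      by (intro tendsto_intros eps f0xs \<sigma>xs)
    ultimately have "f0 (xs N) + 0 * \<sigma> (xs N) \<le> f0 a + 0 * \<sigma> a"
      by (rule LIMSEQ_le) (use max that in blast)
    then show ?thesis by simp
  qed
  obtain L where L: "0 \<le> L" "\<forall>\<^sub>F x in nhds a. norm (\<sigma> x - \<sigma> a) \<le> L * norm (x - a)"
    using differentiable_imp_locally_lipschitz_at[OF \<sigma>] by blast
  show ?thesis
  proof
    show "0 \<le> L / c" using L \<open>0 < c\<close> by simp
    have "\<forall>\<^sub>F N in sequentially. norm (\<sigma> (xs N) - \<sigma> a) \<le> L * norm (xs N - a)"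
      using eventually_compose_filterlim[OF L(2) xs] .
    then show "\<forall>\<^sub>F N in sequentially. norm (xs N - a) \<le> L / c * eps N"
      using growth eventually_ge_at_top[of N0]
    proof eventually_elim
      case (elim N)
      let ?d = "norm (xs N - a)"
      have "c * ?d\<^sup>2 \<le> eps N * (\<sigma> (xs N) - \<sigma> a)"
        using elim(2) limit_max[OF elim(3)] by (simp add: algebra_simps)
      also have "\<dots> \<le> eps N * (L * ?d)"
        using elim(1) eps(2)[OF elim(3)] by (intro mult_left_mono) (auto simp: abs_le_iff)
      finally have "?d * (c * ?d) \<le> ?d * (eps N * L)" by (simp add: power2_eq_square mult_ac)
      then have "?d = 0 \<or> c * ?d \<le> eps N * L"
        by (metis mult_le_cancel_left_pos norm_ge_zero order_le_less)
      then show ?case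
        using \<open>0 < c\<close> L(1) eps(2)[OF elim(3)] by (auto simp: field_simps)
    qed
  qed
qed

section \<open>Rate of concentration\<close>

text \<open>
  A function that is \<open>O(norm x)\<close> near the maximum and has at most exponential growth away from it has
  expectation \<open>O(1 / sqrt N + eps N)\<close>. The first term comes from the fluctuations around the
  maximiser \<open>xs N\<close>, the second from the distance between \<open>xs N\<close> and its limit \<open>0\<close>; the
  contribution from outside \<open>B\<close> is exponentially small.
\<close>

lemma gibbs_moment_rate:
  fixes f :: "real^'n \<Rightarrow> nat \<Rightarrow> real" and M :: "nat \<Rightarrow> 'w measure" and X :: "nat \<Rightarrow> 'w \<Rightarrow> real^'n"
  assumes "0 < N0" "0 < c" "0 \<le> C" "0 \<le> L" "0 < \<Delta>" "0 \<le> A"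
    and S: "S \<in> sets borel"
    and growth: "\<forall>\<^sub>F N in sequentially. \<forall>x \<in> S \<inter> B. f x N \<le> f (xs N) N - c * aniso I (x - xs N)"
      "\<forall>\<^sub>F N in sequentially. \<forall>x \<in> cbox (xs N) (xs N + (\<chi> i. 1 / rate I N i)).
        x \<in> S \<and> f (xs N) N - C * aniso I (x - xs N) \<le> f x N"
    and drift: "\<forall>\<^sub>F N in sequentially. norm (xs N) \<le> L * eps N"
    and eps: "\<And>N. N0 \<le> N \<Longrightarrow> 0 \<le> eps N"
    and gap: "\<And>N x. N0 \<le> N \<Longrightarrow> x \<in> S - B \<Longrightarrow> f x N \<le> f (xs N) N - \<Delta>"
    and bounded: "\<And>N. N0 \<le> N \<Longrightarrow> \<bar>f (xs N) N\<bar> \<le> K"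
    and int: "\<And>N. N0 \<le> N \<Longrightarrow> set_integrable lebesgue S (\<lambda>x. exp (real N * f x N))"
    and tail: "\<And>N. N0 \<le> N \<Longrightarrow> set_integrable lebesgue S (\<lambda>x. (exp (\<xi> \<bullet> x) + 1) * exp (real N0 * f x N))"
      "\<And>N. N0 \<le> N \<Longrightarrow> (LINT x:S|lebesgue. (exp (\<xi> \<bullet> x) + 1) * exp (real N0 * f x N)) \<le> T"
    and prob: "\<And>N. N0 \<le> N \<Longrightarrow> prob_space (M N)"
    and X: "\<And>N. N0 \<le> N \<Longrightarrow> X N \<in> borel_measurable (M N)"
      "\<And>N \<omega>. N0 \<le> N \<Longrightarrow> \<omega> \<in> space (M N) \<Longrightarrow> X N \<omega> \<in> S"
    and law: "\<And>N A. N0 \<le> N \<Longrightarrow> A \<in> sets borel \<Longrightarrow> A \<subseteq> S \<Longrightarrow>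
      measure (M N) {\<omega> \<in> space (M N). X N \<omega> \<in> A} =
        (LINT x:A|lebesgue. exp (real N * f x N)) / (LINT x:S|lebesgue. exp (real N * f x N))"
    and \<phi>[measurable]: "\<phi> \<in> borel_measurable borel"
    and near: "\<And>x. x \<in> S \<inter> B \<Longrightarrow> \<phi> x \<le> A * norm x"
    and far: "\<And>x. x \<in> S - B \<Longrightarrow> \<phi> x \<le> A * (exp (\<xi> \<bullet> x) + 1)"
  obtains D where "0 \<le> D"
    "\<forall>\<^sub>F N in sequentially. (\<integral>\<^sup>+\<omega>. ennreal (\<phi> (X N \<omega>)) \<partial>M N) \<le> ennreal (D * (1 / sqrt (real N) + eps N))"
proof -
  obtain J where J: "0 \<le> J" "\<And>N. 0 < N \<Longrightarrow>
      (\<integral>\<^sup>+v. ennreal ((1 + sqrt N * norm v) * exp (- c * (real N * aniso I v))) \<partial>lborel) \<le> ennreal (J * box_volume I N)"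
    by (rule aniso_moment_bound[OF \<open>0 < c\<close>, of I]) blast
  obtain E where E: "0 \<le> E" "\<And>N. 0 < N \<Longrightarrow> real N ^ CARD('n) * exp (- real N * \<Delta>) \<le> E / sqrt N"
    by (rule power_exp_decay[OF \<open>0 < \<Delta>\<close>, of "CARD('n)"]) blast
  define m where "m = exp (- C * CARD('n))"
  have m: "0 < m" by (simp add: m_def)
  define Q where "Q = T * exp (real N0 * K) * exp (real N0 * \<Delta>)"
  have "0 \<le> (LINT x:S|lebesgue. (exp (\<xi> \<bullet> x) + 1) * exp (real N0 * f x N0))"
    unfolding set_lebesgue_integral_def
    by (intro Bochner_Integration.integral_nonneg) (auto simp: indicator_def add_nonneg_nonneg)
  then have T: "0 \<le> T" using tail(2)[of N0] by simp
  then have Q: "0 \<le> Q" by (simp add: Q_def)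
  show ?thesis
  proof
    show "0 \<le> A / m * (J + L * J + Q * E)"
      using \<open>0 \<le> A\<close> \<open>0 \<le> L\<close> m J(1) Q E(1) by simp
    show "\<forall>\<^sub>F N in sequentially. (\<integral>\<^sup>+\<omega>. ennreal (\<phi> (X N \<omega>)) \<partial>M N)
        \<le> ennreal (A / m * (J + L * J + Q * E) * (1 / sqrt (real N) + eps N))"
      using growth drift eventually_ge_at_top[of N0]
    proof eventually_elim
      case (elim N)
      then have N: "0 < N" "N0 \<le> N" using \<open>0 < N0\<close> by auto
      define Z where "Z = (LINT x:S|lebesgue. exp (real N * f x N))"
      define s where "s = 1 / sqrt (real N)"
      have s: "0 \<le> s" by (simp add: s_def)
      have V: "0 < box_volume I N" by (rule box_volume_pos[OF N(1)])
      have Zlow: "exp (real N * f (xs N) N) * (m * box_volume I N) \<le> Z"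
        unfolding Z_def m_def
      proof (rule partition_function_lower[OF N(1) \<open>0 \<le> C\<close> _ int[OF N(2)]])
        show "S \<in> sets lebesgue" using S by (simp add: sets_completionI_sets)
      qed (use elim(2) in blast)
      have "0 < exp (real N * f (xs N) N) * (m * box_volume I N)" using m V by simp
      then have Z: "0 < Z" using Zlow by linarith
      have "(\<integral>\<^sup>+\<omega>. ennreal (\<phi> (X N \<omega>)) \<partial>M N)
          = (\<integral>\<^sup>+x. ennreal (\<phi> x) * ennreal (indicator S x * exp (real N * f x N) / Z) \<partial>lebesgue)"
        by (rule nn_integral_gibbs[where \<phi> = "\<lambda>x. ennreal (\<phi> x)",
              OF prob[OF N(2)] X[OF N(2)] S int[OF N(2)] _ Z law[OF N(2), folded Z_def]]) simp_all
      also have "\<dots> \<le> ennreal (A / m * ((1 / sqrt N + norm (xs N)) * J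
          + T * exp (real N0 * K) * exp (- (real N - real N0) * \<Delta>) / box_volume I N))"
        by (rule gibbs_moment_bound[OF N \<open>0 \<le> A\<close> m Zlow elim(1)[rule_format] near gap[OF N(2)] far
              bounded[OF N(2)] tail[OF N(2)] J(1) J(2)[OF N(1)]])
      also have "\<dots> \<le> ennreal (A / m * (J + L * J + Q * E) * (s + eps N))"
      proof (rule ennreal_leI)
        have "- (real N - real N0) * \<Delta> = real N0 * \<Delta> + - real N * \<Delta>"
          by (simp add: left_diff_distrib)
        then have "exp (- (real N - real N0) * \<Delta>) / box_volume I N
            = exp (real N0 * \<Delta>) * (exp (- real N * \<Delta>) * (1 / box_volume I N))"
          by (simp only: exp_add times_divide_eq_right mult_1_right mult.assoc)
        also have "\<dots> \<le> exp (real N0 * \<Delta>) * (exp (- real N * \<Delta>) * real N ^ CARD('n))"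
          by (intro mult_left_mono inverse_box_volume_le N) auto
        also have "\<dots> \<le> exp (real N0 * \<Delta>) * (E * s)"
          using E(2)[OF N(1)] by (intro mult_left_mono) (auto simp: s_def mult.commute)
        finally have "T * exp (real N0 * K) * (exp (- (real N - real N0) * \<Delta>) / box_volume I N)
            \<le> T * exp (real N0 * K) * (exp (real N0 * \<Delta>) * (E * s))"
          using T by (intro mult_left_mono) auto
        also have "\<dots> = Q * E * s" by (simp add: Q_def)
        finally have 1: "T * exp (real N0 * K) * exp (- (real N - real N0) * \<Delta>) / box_volume I N \<le> Q * E * s"
          by simp
        have "(s + norm (xs N)) * J \<le> (s + L * eps N) * J"
          using elim(3) J(1) by (intro mult_right_mono) auto
        moreover have "0 \<le> J * eps N" "0 \<le> L * J * s" "0 \<le> Q * E * eps N"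
          using J(1) \<open>0 \<le> L\<close> Q E(1) s eps[OF N(2)] by auto
        ultimately have "(s + norm (xs N)) * J
            + T * exp (real N0 * K) * exp (- (real N - real N0) * \<Delta>) / box_volume I N
            \<le> (J + L * J + Q * E) * (s + eps N)"
          using 1 by (simp add: algebra_simps)
        then show "A / m * ((1 / sqrt N + norm (xs N)) * J
            + T * exp (real N0 * K) * exp (- (real N - real N0) * \<Delta>) / box_volume I N)
            \<le> A / m * (J + L * J + Q * E) * (s + eps N)"
          unfolding s_def[symmetric] mult.assoc[of "A / m"] using \<open>0 \<le> A\<close> m by (intro mult_left_mono) auto
      qed
      finally show ?case by (simp add: s_def)
    qed
  qed
qed

section \<open>Expectations and weak convergence\<close>

lemma abs_exp_minus_one_le: "\<bar>exp u - 1\<bar> \<le> \<bar>u\<bar> * exp \<bar>u\<bar>" for u :: real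
proof (cases "0 \<le> u")
  case True
  have "1 - u \<le> exp (- u)" using exp_ge_add_one_self[of "- u"] by simp
  then have "(1 - u) * exp u \<le> exp (- u) * exp u" by (intro mult_right_mono) auto
  also have "\<dots> = 1" by (simp add: exp_minus)
  finally show ?thesis using True by (simp add: algebra_simps)
next
  case False
  have "1 + u \<le> exp u" by (rule exp_ge_add_one_self)
  moreover have "- u * 1 \<le> - u * exp (- u)" using False by (intro mult_left_mono) auto
  ultimately have "1 - exp u \<le> - (u * exp (- u))" by linarith
  then show ?thesis using False by (simp add: abs_if)
qed

lemma integrable_abs_integral_le:
  fixes g :: "'w \<Rightarrow> real"
  assumes "g \<in> borel_measurable M" and le: "(\<integral>\<^sup>+\<omega>. ennreal \<bar>g \<omega>\<bar> \<partial>M) \<le> ennreal d" and "0 \<le> d"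
  shows "integrable M g" and "\<bar>\<integral>\<omega>. g \<omega> \<partial>M\<bar> \<le> d"
proof -
  show i: "integrable M g"
    using assms(1) le_less_trans[OF le] by (intro integrableI_bounded) auto
  then have "ennreal (\<integral>\<omega>. \<bar>g \<omega>\<bar> \<partial>M) \<le> ennreal d"
    using le by (subst nn_integral_eq_integral[symmetric]) auto
  then have "(\<integral>\<omega>. \<bar>g \<omega>\<bar> \<partial>M) \<le> d" using \<open>0 \<le> d\<close> by (simp add: ennreal_le_iff)
  then show "\<bar>\<integral>\<omega>. g \<omega> \<partial>M\<bar> \<le> d" using integral_abs_bound[of M g] by linarith
qed

text \<open>
  Convergence in probability to \<open>0\<close> implies convergence in distribution.
\<close>

lemma weak_conv_vec_return_0I:
  fixes X :: "nat \<Rightarrow> 'w \<Rightarrow> real^'n"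
  assumes prob: "\<And>N. N0 \<le> N \<Longrightarrow> prob_space (M N)"
    and X: "\<And>N. N0 \<le> N \<Longrightarrow> X N \<in> borel_measurable (M N)"
    and small: "\<And>\<delta>. 0 < \<delta> \<Longrightarrow> (\<lambda>N. measure (M N) {\<omega> \<in> space (M N). \<delta> < norm (X N \<omega>)}) \<longlonglongrightarrow> 0"
  shows "weak_conv_vec (\<lambda>N. distr (M N) borel (X N)) (return borel 0)"
  unfolding weak_conv_vec_def
proof (intro allI impI)
  fix \<phi> :: "real^'n \<Rightarrow> real" assume \<phi>: "continuous_on UNIV \<phi> \<and> bounded (range \<phi>)"
  then obtain b where b: "\<And>x. \<bar>\<phi> x\<bar> \<le> b" by (auto simp: bounded_iff)
  have [measurable]: "\<phi> \<in> borel_measurable borel" using \<phi> by (intro borel_measurable_continuous_onI) auto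
  have b0: "0 \<le> b" using b[of 0] by linarith
  have "(\<lambda>N. \<integral>x. \<phi> x \<partial>distr (M N) borel (X N)) \<longlonglongrightarrow> \<phi> 0"
  proof (rule LIMSEQ_I)
    fix e :: real assume "0 < e"
    then obtain \<delta> where \<delta>: "0 < \<delta>" "\<And>x. dist x 0 < \<delta> \<Longrightarrow> dist (\<phi> x) (\<phi> 0) < e / 2"
      using \<phi> unfolding continuous_on_iff by (metis UNIV_I half_gt_zero)
    define p where "p N = measure (M N) {\<omega> \<in> space (M N). \<delta> / 2 < norm (X N \<omega>)}" for N
    have "\<forall>\<^sub>F N in sequentially. p N < e / (4 * b + 4)"
      using small[of "\<delta> / 2"] \<delta>(1) b0 \<open>0 < e\<close> unfolding p_def by (intro order_tendstoD(2)) auto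
    then obtain N1 where N1: "\<And>N. N1 \<le> N \<Longrightarrow> p N < e / (4 * b + 4)"
      unfolding eventually_sequentially by blast
    have "norm ((\<integral>x. \<phi> x \<partial>distr (M N) borel (X N)) - \<phi> 0) < e" if N: "max N0 N1 \<le> N" for N
    proof -
      interpret prob_space "M N" using prob N by simp
      have [measurable]: "X N \<in> borel_measurable (M N)" using X N by simp
      let ?U = "{\<omega> \<in> space (M N). \<delta> / 2 < norm (X N \<omega>)}"
      have int: "integrable (M N) (\<lambda>\<omega>. \<phi> (X N \<omega>))"
        by (rule integrable_const_bound[where B = b]) (use b in auto)
      have intU: "integrable (M N) (indicator ?U :: 'w \<Rightarrow> real)"
        by (intro integrable_real_indicator) (auto simp: emeasure_eq_measure)
      have "(\<integral>x. \<phi> x \<partial>distr (M N) borel (X N)) - \<phi> 0 = (\<integral>\<omega>. \<phi> (X N \<omega>) - \<phi> 0 \<partial>M N)"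
        using int by (simp add: integral_distr prob_space)
      also have "\<bar>\<dots>\<bar> \<le> (\<integral>\<omega>. \<bar>\<phi> (X N \<omega>) - \<phi> 0\<bar> \<partial>M N)" by (rule integral_abs_bound)
      also have "\<dots> \<le> (\<integral>\<omega>. e / 2 + 2 * b * indicator ?U \<omega> \<partial>M N)"
      proof (rule integral_mono)
        fix \<omega> assume \<omega>: "\<omega> \<in> space (M N)"
        show "\<bar>\<phi> (X N \<omega>) - \<phi> 0\<bar> \<le> e / 2 + 2 * b * indicator ?U \<omega>"
        proof (cases "\<omega> \<in> ?U")
          case True
          then show ?thesis using b[of "X N \<omega>"] b[of 0] \<open>0 < e\<close> by simp
        next
          case False
          then have "dist (X N \<omega>) 0 < \<delta>" using \<omega> \<delta>(1) by simp
          from \<delta>(2)[OF this] show ?thesis using False by (simp add: dist_real_def)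
        qed
      qed (use int intU in auto)
      also have "\<dots> = e / 2 + 2 * b * p N"
        using intU by (simp add: p_def prob_space)
      also have "\<dots> < e"
      proof -
        have "(4 * b + 4) * p N < e" using N1[of N] N b0 by (simp add: field_simps)
        moreover have "0 \<le> p N" by (simp add: p_def)
        ultimately show ?thesis by (simp add: algebra_simps)
      qed
      finally show ?thesis by simp
    qed
    then show "\<exists>no. \<forall>N\<ge>no. norm ((\<integral>x. \<phi> x \<partial>distr (M N) borel (X N)) - \<phi> 0) < e" by blast
  qed
  then show "(\<lambda>N. \<integral>x. \<phi> x \<partial>distr (M N) borel (X N)) \<longlonglongrightarrow> (\<integral>x. \<phi> x \<partial>return borel 0)"
    by (simp add: integral_return)
qed

section \<open>Convergence of the Gibbs laws and their moment generating functions\<close>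

theorem theorem4:
  fixes f :: "real^'n \<Rightarrow> nat \<Rightarrow> real"
    and \<Omega> \<Omega>' \<Omega>p :: "(real^'n) set"
    and r h :: real
    and k :: 'n
    and N0 :: nat
    and xs :: "nat \<Rightarrow> real^'n"
    and xstar :: "real^'n"
    and f0 \<sigma> :: "real^'n \<Rightarrow> real"
    and eps :: "nat \<Rightarrow> real"
    and M :: "nat \<Rightarrow> 'w measure"
    and X :: "nat \<Rightarrow> 'w \<Rightarrow> real^'n"
  assumes "open \<Omega>" and "0 < r" and "\<Omega>' = cball 0 r" and "\<Omega>' \<subseteq> \<Omega>"
    and "\<And>N. 0 < N \<Longrightarrow> thrice_differentiable_on (\<lambda>z. f z N) \<Omega>'"
    and "\<exists>K. \<forall>N>0. \<forall>x\<in>\<Omega>'. \<bar>f x N\<bar> \<le> K \<and> norm (grad (\<lambda>z. f z N) \<Omega>' x) \<le> K \<and>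
           mat_norm (hess (\<lambda>z. f z N) \<Omega>' x) \<le> K \<and>
           trilinear_norm (third_deriv (\<lambda>z. f z N) \<Omega>' x) \<le> K"
    and "\<And>N x. 0 < N \<Longrightarrow> x \<in> \<Omega>' \<Longrightarrow> invertible (hess (\<lambda>z. f z N) \<Omega>' x)"
    and "0 < N0"
    and "\<And>N x. N0 \<le> N \<Longrightarrow> is_arg_max (\<lambda>z. f z N) (\<lambda>z. z \<in> \<Omega>p) x \<longleftrightarrow> x = xs N"
    and "\<And>N. N0 \<le> N \<Longrightarrow> xs N \<in> \<Omega>'"
    and "0 < (INF (N, x)\<in>{N0..} \<times> (\<Omega>p - \<Omega>'). ereal (f (xs N) N - f x N))"
    and "xs \<longlonglongrightarrow> xstar" and "xstar = 0"
    and "\<Omega>p = \<Omega> \<and> interior_max_case f \<Omega>' N0 xs \<or>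
           \<Omega>p = \<Omega> \<inter> {x. 0 \<le> x $ k} \<and> boundary_max_case f \<Omega>' r k N0 xs"
    and "\<And>N x. 0 < N \<Longrightarrow> x \<in> \<Omega> \<Longrightarrow> f x N = f0 x + eps N * \<sigma> x"
    and "twice_differentiable_at f0 xstar" and "twice_differentiable_at \<sigma> xstar"
    and "invertible (hess f0 UNIV xstar)"
    and "\<And>N. 0 < N \<Longrightarrow> 0 < eps N" and "eps \<longlonglongrightarrow> 0"
    and "0 < h"
    and "\<And>\<xi> N. norm \<xi> < h \<Longrightarrow> N0 \<le> N \<Longrightarrow>
           set_integrable lebesgue \<Omega>p (\<lambda>x. exp (\<xi> \<bullet> x) * exp (real N * f x N))"
    and "\<And>\<xi>. norm \<xi> < h \<Longrightarrow> \<exists>C>0. \<forall>N\<ge>N0.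
           set_integrable lebesgue \<Omega> (\<lambda>x. exp (\<xi> \<bullet> x) * exp (real N0 * f x N)) \<and>
           (LINT x:\<Omega>|lebesgue. exp (\<xi> \<bullet> x) * exp (real N0 * f x N)) \<le> C"
    and "\<And>N. N0 \<le> N \<Longrightarrow> prob_space (M N)"
    and "\<And>N. N0 \<le> N \<Longrightarrow> X N \<in> borel_measurable (M N)"
    and "\<And>N \<omega>. N0 \<le> N \<Longrightarrow> \<omega> \<in> space (M N) \<Longrightarrow> X N \<omega> \<in> \<Omega>p"
    and "\<And>N A. N0 \<le> N \<Longrightarrow> A \<in> sets borel \<Longrightarrow> A \<subseteq> \<Omega>p \<Longrightarrow>
           measure (M N) {\<omega> \<in> space (M N). X N \<omega> \<in> A} =
             (LINT x:A|lebesgue. exp (real N * f x N)) / (LINT x:\<Omega>p|lebesgue. exp (real N * f x N))"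
  shows "weak_conv_vec (\<lambda>N. distr (M N) borel (X N)) (return borel xstar) \<and>
    (\<forall>\<xi>. norm \<xi> < h \<longrightarrow>
       (\<exists>a b. a \<in> O(\<lambda>_. 1) \<and> b \<in> O(\<lambda>_. 1) \<and>
          (\<forall>\<^sub>F N in sequentially.
             mgf (M N) (X N) \<xi> = exp (\<xi> \<bullet> xstar) * (1 + a N / sqrt (real N) + b N * eps N))))"
proof -
  note B = \<open>\<Omega>' = cball 0 r\<close>
  note xstar = \<open>xstar = 0\<close>
  have xs: "xs \<longlonglongrightarrow> 0" using assms(12) xstar by simp
  obtain K where K: "\<And>N x. 0 < N \<Longrightarrow> x \<in> \<Omega>' \<Longrightarrow> \<bar>f x N\<bar> \<le> K"
      "\<And>N x. 0 < N \<Longrightarrow> x \<in> \<Omega>' \<Longrightarrow> norm (grad (\<lambda>z. f z N) \<Omega>' x) \<le> K"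
      "\<And>N x. 0 < N \<Longrightarrow> x \<in> \<Omega>' \<Longrightarrow> mat_norm (hess (\<lambda>z. f z N) \<Omega>' x) \<le> K"
    using assms(6) by blast
  have argmax: "is_arg_max (\<lambda>z. f z N) (\<lambda>z. z \<in> \<Omega>p) (xs N)" if "N0 \<le> N" for N
    using assms(9)[OF that] by simp
  have xs_in: "xs N \<in> \<Omega>p" if "N0 \<le> N" for N
    using argmax[OF that] by (simp add: is_arg_max_def)
  have max: "f x N \<le> f (xs N) N" if "N0 \<le> N" "x \<in> \<Omega>p" for N x
    using argmax[OF that(1)] that(2) by (auto simp: is_arg_max_def not_less)
  have sub: "\<Omega>p \<subseteq> \<Omega>" and zero: "0 \<in> \<Omega>p \<inter> \<Omega>'"
    using assms(2,4,14) B by auto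
  have borel: "\<Omega>p \<in> sets borel"
  proof -
    have "\<Omega> \<in> sets borel" using \<open>open \<Omega>\<close> by simp
    moreover have "closed {x :: real^'n. 0 \<le> x $ k}"
      by (intro closed_Collect_le continuous_intros)
    then have "{x :: real^'n. 0 \<le> x $ k} \<in> sets borel" by simp
    ultimately show ?thesis using assms(14) by auto
  qed
  obtain \<Delta> where \<Delta>: "0 < \<Delta>"
      "\<And>p. p \<in> {N0..} \<times> (\<Omega>p - \<Omega>') \<Longrightarrow> ereal \<Delta> \<le> ereal (f (xs (fst p)) (fst p) - f (snd p) (fst p))"
    using INF_ereal_pos_obtain[OF assms(11)[unfolded case_prod_beta]] by blast
  have gap: "f x N \<le> f (xs N) N - \<Delta>" if "N0 \<le> N" "x \<in> \<Omega>p - \<Omega>'" for N x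
    using \<Delta>(2)[of "(N, x)"] that by simp
  obtain I c C where growth: "0 < c" "0 \<le> C"
      "\<forall>\<^sub>F N in sequentially. \<forall>x \<in> \<Omega>p \<inter> \<Omega>'. f x N \<le> f (xs N) N - c * aniso I (x - xs N)"
      "\<forall>\<^sub>F N in sequentially. \<forall>x \<in> cbox (xs N) (xs N + (\<chi> i. 1 / rate I N i)).
        x \<in> \<Omega>p \<and> f (xs N) N - C * aniso I (x - xs N) \<le> f x N"
    unfolding B
    by (rule anisotropic_growth[OF assms(2) assms(4)[unfolded B] assms(5)[unfolded B]
          K(2,3)[unfolded B] assms(8) max xs assms(14)[unfolded B]]) blast+
  have eps: "0 \<le> eps N" if "N0 \<le> N" for N
    using assms(19)[of N] assms(8) that by simp
  obtain L where L: "0 \<le> L" "\<forall>\<^sub>F N in sequentially. norm (xs N) \<le> L * eps N"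
  proof (rule maximiser_drift[of f0 0 \<sigma> xs eps N0 c])
    show "f0 differentiable (at 0)" "\<sigma> differentiable (at 0)"
      using assms(16,17) xstar eventually_nhds_x_imp_x by (auto simp: twice_differentiable_at_def)
    show "f0 (xs N) + eps N' * \<sigma> (xs N) \<le> f0 (xs N') + eps N' * \<sigma> (xs N')"
      if "N0 \<le> N" "N0 \<le> N'" for N N'
    proof -
      have "xs N \<in> \<Omega>" "xs N' \<in> \<Omega>" using xs_in that sub by blast+
      then show ?thesis
        using max[OF that(2) xs_in[OF that(1)]] assms(15)[of N' "xs N"] assms(15)[of N' "xs N'"]
          that assms(8) by simp
    qed
    have "\<forall>\<^sub>F N in sequentially. dist (xs N) 0 < 1"
      using tendstoD[OF xs, of 1] by simp
    then show "\<forall>\<^sub>F N in sequentially.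
        f0 0 + eps N * \<sigma> 0 \<le> f0 (xs N) + eps N * \<sigma> (xs N) - c * (norm (xs N - 0))\<^sup>2"
      using growth(3) eventually_ge_at_top[of N0]
    proof eventually_elim
      case (elim N)
      have "(norm (xs N))\<^sup>2 \<le> aniso I (0 - xs N)"
        using norm_sq_le_aniso[of "0 - xs N" I] elim(1) by simp
      then have "c * (norm (xs N))\<^sup>2 \<le> c * aniso I (0 - xs N)"
        using growth(1) by (intro mult_left_mono) auto
      moreover have "f 0 N \<le> f (xs N) N - c * aniso I (0 - xs N)"
        using elim(2) zero by blast
      moreover have "0 \<in> \<Omega>" "xs N \<in> \<Omega>" using sub zero xs_in[OF elim(3)] by blast+
      ultimately show ?case
        using assms(15)[of N 0] assms(15)[of N "xs N"] elim(3) assms(8) by simp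
    qed
  qed (use xs assms(20) eps growth(1) that in auto)
  have norm_bound: "\<bar>f (xs N) N\<bar> \<le> K" if "N0 \<le> N" for N
    using K(1)[of N "xs N"] assms(8,10) that by auto
  have int: "set_integrable lebesgue \<Omega>p (\<lambda>x. exp (real N * f x N))" if "N0 \<le> N" for N
    using assms(22)[of 0 N] assms(21) that by simp
  \<comment> \<open>Used for an indicator function to get the convergence in distribution and for
    \<open>\<bar>exp (\<xi> \<bullet> x) - 1\<bar>\<close> to get the moment generating function.\<close>
  have rate: "\<exists>D\<ge>0. \<forall>\<^sub>F N in sequentially.
      (\<integral>\<^sup>+\<omega>. ennreal (\<phi> (X N \<omega>)) \<partial>M N) \<le> ennreal (D * (1 / sqrt (real N) + eps N))"
    if \<xi>: "norm \<xi> < h" and \<phi>: "\<phi> \<in> borel_measurable borel" and "0 \<le> A"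
      and near: "\<And>x. x \<in> \<Omega>p \<inter> \<Omega>' \<Longrightarrow> \<phi> x \<le> A * norm x"
      and far: "\<And>x. x \<in> \<Omega>p - \<Omega>' \<Longrightarrow> \<phi> x \<le> A * (exp (\<xi> \<bullet> x) + 1)"
    for \<xi> A and \<phi> :: "real^'n \<Rightarrow> real"
  proof -
    define E where "E \<zeta> N x = exp (\<zeta> \<bullet> x) * exp (real N0 * f x N)" for \<zeta> N x
    have split: "(exp (\<xi> \<bullet> x) + 1) * exp (real N0 * f x N) = E \<xi> N x + E 0 N x" for N x
      by (simp add: E_def distrib_right)
    obtain C1 where C1: "\<And>N. N0 \<le> N \<Longrightarrow> set_integrable lebesgue \<Omega> (E \<xi> N)"
        "\<And>N. N0 \<le> N \<Longrightarrow> (LINT x:\<Omega>|lebesgue. E \<xi> N x) \<le> C1"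
      using assms(23)[OF \<xi>] unfolding E_def by blast
    have "norm (0 :: real^'n) < h" using assms(21) by simp
    from assms(23)[OF this] obtain C0 where C0: "\<And>N. N0 \<le> N \<Longrightarrow> set_integrable lebesgue \<Omega> (E 0 N)"
        "\<And>N. N0 \<le> N \<Longrightarrow> (LINT x:\<Omega>|lebesgue. E 0 N x) \<le> C0"
      unfolding E_def by blast
    have tail: "set_integrable lebesgue \<Omega>p (\<lambda>x. E \<xi> N x + E 0 N x)"
        "(LINT x:\<Omega>p|lebesgue. E \<xi> N x + E 0 N x) \<le> C1 + C0" if N: "N0 \<le> N" for N
    proof -
      have i: "set_integrable lebesgue \<Omega> (\<lambda>x. E \<xi> N x + E 0 N x)"
        using C1(1)[OF N] C0(1)[OF N] by (rule set_integral_add)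
      show ip: "set_integrable lebesgue \<Omega>p (\<lambda>x. E \<xi> N x + E 0 N x)"
        using i by (rule set_integrable_subset) (use borel sub in \<open>auto simp: sets_completionI_sets\<close>)
      have "(LINT x:\<Omega>p|lebesgue. E \<xi> N x + E 0 N x) \<le> (LINT x:\<Omega>|lebesgue. E \<xi> N x + E 0 N x)"
        unfolding set_lebesgue_integral_def
        by (rule integral_mono)
          (use i ip sub in \<open>auto simp: set_integrable_def indicator_def E_def add_nonneg_nonneg\<close>)
      also have "\<dots> = (LINT x:\<Omega>|lebesgue. E \<xi> N x) + (LINT x:\<Omega>|lebesgue. E 0 N x)"
        using C1(1)[OF N] C0(1)[OF N] by (rule set_integral_add)
      also have "\<dots> \<le> C1 + C0" using C1(2)[OF N] C0(2)[OF N] by (rule add_mono)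
      finally show "(LINT x:\<Omega>p|lebesgue. E \<xi> N x + E 0 N x) \<le> C1 + C0" .
    qed
    obtain D where "0 \<le> D" "\<forall>\<^sub>F N in sequentially.
        (\<integral>\<^sup>+\<omega>. ennreal (\<phi> (X N \<omega>)) \<partial>M N) \<le> ennreal (D * (1 / sqrt (real N) + eps N))"
      by (rule gibbs_moment_rate[OF assms(8) growth(1,2) L(1) \<Delta>(1) \<open>0 \<le> A\<close> borel growth(3,4) L(2)
            eps gap norm_bound int tail[folded split] assms(24-27) \<phi> near far]) blast+
    then show ?thesis by blast
  qed
  have vanishing: "(\<lambda>N. D * (1 / sqrt (real N) + eps N)) \<longlonglongrightarrow> 0" for D
  proof -
    have "(\<lambda>N. sqrt (1 / real N)) \<longlonglongrightarrow> sqrt 0"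
      by (intro tendsto_real_sqrt lim_1_over_n)
    then have "(\<lambda>N. D * (1 / sqrt (real N) + eps N)) \<longlonglongrightarrow> D * (0 + 0)"
      using assms(20) by (intro tendsto_intros) (simp_all add: real_sqrt_divide)
    then show ?thesis by simp
  qed
  have "weak_conv_vec (\<lambda>N. distr (M N) borel (X N)) (return borel xstar)"
    unfolding xstar
  proof (rule weak_conv_vec_return_0I[OF assms(24,25)])
    fix \<delta> :: real assume \<delta>: "0 < \<delta>"
    let ?U = "{x :: real^'n. \<delta> < norm x}"
    have U: "?U \<in> sets borel" by measurable
    have "indicator ?U x \<le> (1 / \<delta> + 1) * norm x" for x :: "real^'n"
    proof (cases "x \<in> ?U")
      case True
      then have "1 \<le> 1 / \<delta> * norm x" using \<delta> by (simp add: field_simps)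
      then show ?thesis using True by (simp add: distrib_right add_increasing2)
    qed (use \<delta> in simp)
    moreover have "indicator ?U x \<le> (1 / \<delta> + 1) * (exp (0 \<bullet> x) + 1)" for x :: "real^'n"
      using \<delta> by (simp add: indicator_def)
    moreover have "norm (0 :: real^'n) < h" "0 \<le> 1 / \<delta> + 1" using assms(21) \<delta> by auto
    moreover have "(indicator ?U :: real^'n \<Rightarrow> real) \<in> borel_measurable borel" using U by simp
    ultimately obtain D where D: "0 \<le> D" "\<forall>\<^sub>F N in sequentially.
        (\<integral>\<^sup>+\<omega>. ennreal (indicator ?U (X N \<omega>)) \<partial>M N) \<le> ennreal (D * (1 / sqrt (real N) + eps N))"
      using rate[of 0 "indicator ?U" "1 / \<delta> + 1"] by blast
    show "(\<lambda>N. measure (M N) {\<omega> \<in> space (M N). \<delta> < norm (X N \<omega>)}) \<longlonglongrightarrow> 0"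
    proof (rule tendsto_sandwich[OF _ _ tendsto_const vanishing[of D]])
      show "\<forall>\<^sub>F N in sequentially.
          measure (M N) {\<omega> \<in> space (M N). \<delta> < norm (X N \<omega>)} \<le> D * (1 / sqrt (real N) + eps N)"
        using D(2) eventually_ge_at_top[of N0]
      proof eventually_elim
        case (elim N)
        interpret prob_space "M N" by (rule assms(24)) fact
        have [measurable]: "X N \<in> borel_measurable (M N)" by (rule assms(25)) fact
        let ?V = "{\<omega> \<in> space (M N). \<delta> < norm (X N \<omega>)}"
        have "ennreal (measure (M N) ?V) = (\<integral>\<^sup>+\<omega>. indicator ?V \<omega> \<partial>M N)"
          by (subst nn_integral_indicator) (auto simp: emeasure_eq_measure)
        also have "\<dots> = (\<integral>\<^sup>+\<omega>. ennreal (indicator ?U (X N \<omega>)) \<partial>M N)"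
          by (intro nn_integral_cong) (auto simp: indicator_def)
        also note elim(1)
        finally show ?case
          using D(1) eps[OF elim(2)] by (subst (asm) ennreal_le_iff) auto
      qed
    qed (simp add: always_eventually)
  qed
  moreover have "\<exists>a b. a \<in> O(\<lambda>_. 1) \<and> b \<in> O(\<lambda>_. 1) \<and>
      (\<forall>\<^sub>F N in sequentially.
        mgf (M N) (X N) \<xi> = exp (\<xi> \<bullet> xstar) * (1 + a N / sqrt (real N) + b N * eps N))"
    if \<xi>: "norm \<xi> < h" for \<xi>
  proof -
    define A where "A = norm \<xi> * exp (norm \<xi> * r) + 1"
    have A: "1 \<le> A" by (simp add: A_def)
    have near: "\<bar>exp (\<xi> \<bullet> x) - 1\<bar> \<le> A * norm x" if "x \<in> \<Omega>p \<inter> \<Omega>'" for x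
    proof -
      have u: "\<bar>\<xi> \<bullet> x\<bar> \<le> norm \<xi> * norm x" by (rule Cauchy_Schwarz_ineq2)
      also have "\<dots> \<le> norm \<xi> * r" using that B by (intro mult_left_mono) auto
      finally have "exp \<bar>\<xi> \<bullet> x\<bar> \<le> exp (norm \<xi> * r)" by simp
      then have "\<bar>\<xi> \<bullet> x\<bar> * exp \<bar>\<xi> \<bullet> x\<bar> \<le> norm \<xi> * norm x * exp (norm \<xi> * r)"
        using u by (intro mult_mono) auto
      moreover have "A * norm x = norm \<xi> * norm x * exp (norm \<xi> * r) + norm x"
        by (simp add: A_def algebra_simps)
      ultimately show ?thesis
        using abs_exp_minus_one_le[of "\<xi> \<bullet> x"] norm_ge_zero[of x] by linarith
    qed
    have far: "\<bar>exp (\<xi> \<bullet> x) - 1\<bar> \<le> A * (exp (\<xi> \<bullet> x) + 1)" for x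
    proof -
      have "\<bar>exp (\<xi> \<bullet> x) - 1\<bar> \<le> 1 * (exp (\<xi> \<bullet> x) + 1)"
        using exp_gt_zero[of "\<xi> \<bullet> x"] by (simp add: abs_le_iff)
      also have "\<dots> \<le> A * (exp (\<xi> \<bullet> x) + 1)" using A by (intro mult_right_mono) (auto simp: add_nonneg_nonneg)
      finally show ?thesis .
    qed
    have m: "(\<lambda>x. \<bar>exp (\<xi> \<bullet> x) - 1\<bar>) \<in> borel_measurable borel" by measurable
    have "0 \<le> A" using A by simp
    obtain D where D: "0 \<le> D" "\<forall>\<^sub>F N in sequentially.
        (\<integral>\<^sup>+\<omega>. ennreal \<bar>exp (\<xi> \<bullet> X N \<omega>) - 1\<bar> \<partial>M N) \<le> ennreal (D * (1 / sqrt (real N) + eps N))"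
      using rate[OF \<xi> m \<open>0 \<le> A\<close> near far] by blast
    \<comment> \<open>One bounded coefficient serves for both error terms.\<close>
    define q where "q N = (mgf (M N) (X N) \<xi> - 1) / (1 / sqrt (real N) + eps N)" for N
    have main: "\<forall>\<^sub>F N in sequentially. \<bar>q N\<bar> \<le> D \<and>
        mgf (M N) (X N) \<xi> = exp (\<xi> \<bullet> xstar) * (1 + q N / sqrt (real N) + q N * eps N)"
      using D(2) eventually_ge_at_top[of N0]
    proof eventually_elim
      case (elim N)
      interpret prob_space "M N" by (rule assms(24)) fact
      have [measurable]: "X N \<in> borel_measurable (M N)" by (rule assms(25)) fact
      have s: "0 < 1 / sqrt (real N) + eps N"
        using assms(8) eps[OF elim(2)] elim(2) by (simp add: add_pos_nonneg)
      have d: "0 \<le> D * (1 / sqrt (real N) + eps N)" using D(1) s by simp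
      note g = integrable_abs_integral_le[OF _ elim(1) d]
      have i: "integrable (M N) (\<lambda>\<omega>. exp (\<xi> \<bullet> X N \<omega>) - 1)" by (rule g(1)) measurable
      have "integrable (M N) (\<lambda>\<omega>. (exp (\<xi> \<bullet> X N \<omega>) - 1) + 1)"
        by (rule Bochner_Integration.integrable_add[OF i]) simp
      then have "(\<integral>\<omega>. exp (\<xi> \<bullet> X N \<omega>) - 1 \<partial>M N) = mgf (M N) (X N) \<xi> - 1"
        unfolding mgf_def by (subst Bochner_Integration.integral_diff) (auto simp: prob_space)
      moreover have "\<bar>\<integral>\<omega>. exp (\<xi> \<bullet> X N \<omega>) - 1 \<partial>M N\<bar> \<le> D * (1 / sqrt (real N) + eps N)"
        by (rule g(2)) measurable
      ultimately have "\<bar>mgf (M N) (X N) \<xi> - 1\<bar> \<le> D * (1 / sqrt (real N) + eps N)" by simp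
      then have "\<bar>q N\<bar> \<le> D"
        using s by (simp add: q_def abs_divide abs_of_pos pos_divide_le_eq)
      moreover have "q N * (1 / sqrt (real N) + eps N) = mgf (M N) (X N) \<xi> - 1"
        using s by (simp add: q_def)
      ultimately show ?case by (simp add: xstar algebra_simps)
    qed
    have "\<forall>\<^sub>F N in sequentially. norm (q N) \<le> D * norm (1 :: real)"
      using main by eventually_elim simp
    then have "q \<in> O(\<lambda>_. 1)" by (rule bigoI)
    moreover have "\<forall>\<^sub>F N in sequentially.
        mgf (M N) (X N) \<xi> = exp (\<xi> \<bullet> xstar) * (1 + q N / sqrt (real N) + q N * eps N)"
      using main by eventually_elim blast
    ultimately show ?thesis by blast
  qed
  ultimately show ?thesis by blast
qed

end
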